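(* Every min-edge cut property is a Tutte cut property, and every min-edge cycle property is a Tutte cycle property.
   Context: Graphs are finite, undirected and connected; loops and multiple edges are allowed. A reference orientation $\mathcal{O}_{\mathrm{ref}}$ of $G$ assigns to each edge $e=\{u,v\}$ one of the ordered pairs $(u,v),(v,u)$. Every edge $e$ has two formal orientations $e^+$ and $e^-$ (treated as distinct even if $e$ is a loop): $e^+$ is directed as $\mathcal{O}_{\mathrm{ref}}(e)$ and $e^-$ is directed oppositely; $e^{\varepsilon}=(u,v)$ means $e^\varepsilon$ is directed from $u$ to $v$. Let $\mathbb{E}(G)=\{e^+,e^-: e\in E(G)\}$. An ordered, oriented graph is a triple $\mathbb{G}=(G,\mathcal{O}_{\mathrm{ref}},<)$ with $<$ a total order on $E(G)$. A fourientation of $\mathbb{G}$ is a subset $\mathcal{O}\subseteq\mathbb{E}(G)$; $e$ is oriented, unoriented, bioriented in $\mathcal{O}$ if exactly one, none, both of $e^+,e^-$ lie in $\mathcal{O}$. A cut is a partition $Cu=\{U,U^c\}$ of $V(G)$ into two nonempty parts, $E(Cu)$ is the set of edges with one endpoint in each part; it is simple if the induced subgraphs on $U$ and $U^c$ are connected. A directed cut is an ordered pair $\overrightarrow{Cu}=(U,U^c)$, with $E(\overrightarrow{Cu})=E(Cu)$; $\mathbb{E}(\overrightarrow{Cu})$ is the set of edge orientations directed from $U$ to $U^c$. A cycle is a cyclic list $v_1,e_1,\dots,v_k,e_k$ ($k\ge 1$) with distinct edges $e_i=\{v_i,v_{i+1}\}$ (indices mod $k$), up to rotation and reflection; it is simple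 if the $v_i$ are distinct. A directed cycle $\overrightarrow{Cy}=v_1,e_1^{\delta_1},\dots,v_k,e_k^{\delta_k}$ additionally has $e_i^{\delta_i}=(v_i,v_{i+1})$, up to rotation; $E(\overrightarrow{Cy})=\{e_i\}$, $\mathbb{E}(\overrightarrow{Cy})=\{e_i^{\delta_i}\}$. An isthmus is an edge $e$ with $E(Cu)=\{e\}$ for some cut; a loop is an edge joining a vertex to itself. $\overrightarrow{Cu}$ is a potential cut of $\mathcal{O}$ if $e^{\varepsilon}\in\mathbb{E}(\overrightarrow{Cu})$ implies $e^{-\varepsilon}\notin\mathcal{O}$; $\overrightarrow{Cy}$ is a potential cycle of $\mathcal{O}$ if $\mathbb{E}(\overrightarrow{Cy})\subseteq\mathcal{O}$. $\mathbb{G}\setminus e$ and $\mathbb{G}/e$ denote deletion and contraction with induced reference orientation and order. A fourientation $\mathcal{O}$ of $\mathbb{G}\setminus e$ or $\mathbb{G}/e$ is also regarded as the fourientation of $\mathbb{G}$ in which $e$ is unoriented. For a simple cut $Cu$, $\mathbb{G}_{Cu}$ is obtained by contracting all edges not in $E(Cu)$; for a simple cycle $Cy$, $\mathbb{G}_{Cy}$ is obtained by deleting all edges not in $E(Cy)$ and removing isolated vertices; $\mathcal{O}_{C}$ is the fourientation of $\mathbb{G}_C$ induced by $\mathcal{O}$. A fourientation property is a map from pairs $(\mathbb{G},\mathcal{O})$ ($\mathcal{O}$ a fourientation of $\mathbb{G}$) to $\{\mathrm{good},\mathrm{bad}\}$, invariant under isomorphism (bijections of vertices and edges compatible with incidence,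 reference orientation, edge order and $\mathcal{O}$). It is a cut (cycle) property if $\mathcal{O}$ is good for $\mathbb{G}$ if and only if $\mathcal{O}_C$ is good for $\mathbb{G}_C$ for every simple cut (cycle) $C$. A cut (cycle) property is a Tutte cut (cycle) property if for all $\mathbb{G}$ (statements for cycle properties in parentheses): T1: $\mathcal{O}$ is bad for $\mathbb{G}$ only if $\mathcal{O}$ has a potential cut (cycle). T2: if the maximum edge $e$ of $\mathbb{G}$ is neither an isthmus nor a loop, then for every fourientation $\mathcal{O}$ of $\mathbb{G}\setminus e$ ($\mathbb{G}/e$): (a) if $\mathcal{O}$ is good for $\mathbb{G}\setminus e$ ($\mathbb{G}/e$), then $\mathcal{O}\cup\{e^+\}$ and $\mathcal{O}\cup\{e^-\}$ are both good for $\mathbb{G}$; (b) if $\mathcal{O}$ is bad for $\mathbb{G}\setminus e$ ($\mathbb{G}/e$) but $\mathcal{O}\cup\{e^+,e^-\}$ ($\mathcal{O}$) is good for $\mathbb{G}$, then exactly one of $\mathcal{O}\cup\{e^+\}$, $\mathcal{O}\cup\{e^-\}$ is good for $\mathbb{G}$; (c) $\mathcal{O}$ is good for $\mathbb{G}\setminus e$ ($\mathbb{G}/e$) if and only if $\mathcal{O}$ ($\mathcal{O}\cup\{e^+,e^-\}$) is good for $\mathbb{G}$. Min-edge properties. A min-edge cut (cycle) property is given by a set $X\subseteq\{\emptyset,\{-\},\{+\}\}$ (for cycles, $X\subseteq\{\{-\},\{+\},\{-,+\}\}$) and $\delta\in\{+,-\}$. A potential cut (cycle) $\overrightarrow{C}$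 of a fourientation $\mathcal{O}$ of $\mathbb{G}$, with $e_{\min}$ the $<$-minimum edge of $E(\overrightarrow{C})$, is bad with respect to $(X,\delta)$ if both (i) $\{\varepsilon: e_{\min}^{\varepsilon}\in\mathcal{O}\}\in X$, and (ii) if $e_{\min}$ is unoriented (for cycles: bioriented) in $\mathcal{O}$ then $e_{\min}^{\delta}\in\mathbb{E}(\overrightarrow{C})$. Otherwise it is good. $\mathcal{O}$ is good with respect to the min-edge cut (cycle) property $(X,\delta)$ if and only if all of its potential cuts (cycles) are good. *)

theory Defs
  imports "Graph_Theory.Graph_Theory"
begin

section \<open>Ordered, oriented graphs\<close>

text \<open>
  An undirected multigraph with a reference orientation is the same thing as a directed
  multigraph: \<open>tail\<close> and \<open>head\<close> record the ordered pair assigned to each edge.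
  The total order on the edges is given by its reflexive form \<open>le\<close>.
\<close>

record ('v, 'e) ograph =
  gr :: "('v, 'e) pre_digraph"
  le :: "'e rel"

abbreviation V :: "('v, 'e) ograph \<Rightarrow> 'v set" where "V G \<equiv> verts (gr G)"
abbreviation E :: "('v, 'e) ograph \<Rightarrow> 'e set" where "E G \<equiv> arcs (gr G)"

definition ordered_oriented_graph :: "('v, 'e) ograph \<Rightarrow> bool" where
  "ordered_oriented_graph G \<longleftrightarrow>
     fin_digraph (gr G) \<and> Digraph_Component.connected (gr G) \<and> linear_order_on (E G) (le G)"

datatype sign = Plus | Minus

fun opp :: "sign \<Rightarrow> sign" where
  "opp Plus = Minus"
| "opp Minus = Plus"

text \<open>The formal orientation \<open>e\<^sup>\<epsilon>\<close> is the pair \<open>(e, \<epsilon>)\<close>; thus \<open>e\<^sup>+ \<noteq> e\<^sup>-\<close> also for loops.\<close>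

type_synonym 'e dart = "'e \<times> sign"

fun dart_tail :: "('v, 'e) ograph \<Rightarrow> 'e dart \<Rightarrow> 'v" where
  "dart_tail G (e, Plus) = tail (gr G) e"
| "dart_tail G (e, Minus) = head (gr G) e"

fun dart_head :: "('v, 'e) ograph \<Rightarrow> 'e dart \<Rightarrow> 'v" where
  "dart_head G (e, Plus) = head (gr G) e"
| "dart_head G (e, Minus) = tail (gr G) e"

definition darts :: "('v, 'e) ograph \<Rightarrow> 'e dart set" where
  "darts G = E G \<times> UNIV"

definition fourientation :: "('v, 'e) ograph \<Rightarrow> 'e dart set \<Rightarrow> bool" where
  "fourientation G \<O> \<longleftrightarrow> \<O> \<subseteq> darts G"

definition edge_signs :: "'e dart set \<Rightarrow> 'e \<Rightarrow> sign set" where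
  "edge_signs \<O> e = {\<epsilon>. (e, \<epsilon>) \<in> \<O>}"

definition unoriented :: "'e dart set \<Rightarrow> 'e \<Rightarrow> bool" where
  "unoriented \<O> e \<longleftrightarrow> (e, Plus) \<notin> \<O> \<and> (e, Minus) \<notin> \<O>"

definition bioriented :: "'e dart set \<Rightarrow> 'e \<Rightarrow> bool" where
  "bioriented \<O> e \<longleftrightarrow> (e, Plus) \<in> \<O> \<and> (e, Minus) \<in> \<O>"

definition is_min_edge :: "('v, 'e) ograph \<Rightarrow> 'e set \<Rightarrow> 'e \<Rightarrow> bool" where
  "is_min_edge G S e \<longleftrightarrow> e \<in> S \<and> (\<forall>f\<in>S. (e, f) \<in> le G)"

definition min_edge :: "('v, 'e) ograph \<Rightarrow> 'e set \<Rightarrow> 'e" where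
  "min_edge G S = (THE e. is_min_edge G S e)"

definition is_max_edge :: "('v, 'e) ograph \<Rightarrow> 'e \<Rightarrow> bool" where
  "is_max_edge G e \<longleftrightarrow> e \<in> E G \<and> (\<forall>f\<in>E G. (f, e) \<in> le G)"


section \<open>Cuts\<close>

text \<open>
  The set \<open>U\<close> represents the directed cut \<open>(U, U\<^sup>c)\<close>, as well as the undirected cut \<open>{U, U\<^sup>c}\<close>
  in notions that do not distinguish \<open>U\<close> from its complement in \<open>V G\<close>.
\<close>

definition is_cut :: "('v, 'e) ograph \<Rightarrow> 'v set \<Rightarrow> bool" where
  "is_cut G U \<longleftrightarrow> U \<subseteq> V G \<and> U \<noteq> {} \<and> V G - U \<noteq> {}"

definition cut_edges :: "('v, 'e) ograph \<Rightarrow> 'v set \<Rightarrow> 'e set" where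
  "cut_edges G U =
     {e \<in> E G. (tail (gr G) e \<in> U \<and> head (gr G) e \<in> V G - U) \<or>
               (head (gr G) e \<in> U \<and> tail (gr G) e \<in> V G - U)}"

definition cut_darts :: "('v, 'e) ograph \<Rightarrow> 'v set \<Rightarrow> 'e dart set" where
  "cut_darts G U = {d \<in> darts G. dart_tail G d \<in> U \<and> dart_head G d \<in> V G - U}"

definition simple_cut :: "('v, 'e) ograph \<Rightarrow> 'v set \<Rightarrow> bool" where
  "simple_cut G U \<longleftrightarrow> is_cut G U \<and>
     Digraph_Component.connected (gr G \<restriction> U) \<and>
     Digraph_Component.connected (gr G \<restriction> (V G - U))"

definition isthmus :: "('v, 'e) ograph \<Rightarrow> 'e \<Rightarrow> bool" where
  "isthmus G e \<longleftrightarrow> (\<exists>U. is_cut G U \<and> cut_edges G U = {e})"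

definition potential_cut :: "('v, 'e) ograph \<Rightarrow> 'e dart set \<Rightarrow> 'v set \<Rightarrow> bool" where
  "potential_cut G \<O> U \<longleftrightarrow> is_cut G U \<and>
     (\<forall>e \<epsilon>. (e, \<epsilon>) \<in> cut_darts G U \<longrightarrow> (e, opp \<epsilon>) \<notin> \<O>)"


section \<open>Cycles\<close>

text \<open>
  A cycle \<open>v\<^sub>1, e\<^sub>1, \<dots>, v\<^sub>k, e\<^sub>k\<close> is represented by any of the lists \<open>[(v\<^sub>1, e\<^sub>1), \<dots>, (v\<^sub>k, e\<^sub>k)]\<close> that
  describe it. These lists are not quotiented by rotation and reflection (respectively, for
  directed cycles, by rotation), as all notions below are invariant under these operations.
\<close>

definition is_cycle :: "('v, 'e) ograph \<Rightarrow> ('v \<times> 'e) list \<Rightarrow> bool" where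
  "is_cycle G c \<longleftrightarrow> c \<noteq> [] \<and> distinct (map snd c) \<and>
     (\<forall>i<length c. snd (c ! i) \<in> E G \<and>
        {tail (gr G) (snd (c ! i)), head (gr G) (snd (c ! i))} =
        {fst (c ! i), fst (c ! (Suc i mod length c))})"

definition simple_cycle :: "('v, 'e) ograph \<Rightarrow> ('v \<times> 'e) list \<Rightarrow> bool" where
  "simple_cycle G c \<longleftrightarrow> is_cycle G c \<and> distinct (map fst c)"

definition cycle_edges :: "('v \<times> 'e) list \<Rightarrow> 'e set" where
  "cycle_edges c = snd ` set c"

definition is_dcycle :: "('v, 'e) ograph \<Rightarrow> ('v \<times> 'e dart) list \<Rightarrow> bool" where
  "is_dcycle G c \<longleftrightarrow> c \<noteq> [] \<and> distinct (map (fst \<circ> snd) c) \<and>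
     (\<forall>i<length c. snd (c ! i) \<in> darts G \<and>
        dart_tail G (snd (c ! i)) = fst (c ! i) \<and>
        dart_head G (snd (c ! i)) = fst (c ! (Suc i mod length c)))"

definition dcycle_darts :: "('v \<times> 'e dart) list \<Rightarrow> 'e dart set" where
  "dcycle_darts c = snd ` set c"

definition dcycle_edges :: "('v \<times> 'e dart) list \<Rightarrow> 'e set" where
  "dcycle_edges c = fst ` dcycle_darts c"

definition is_loop :: "('v, 'e) ograph \<Rightarrow> 'e \<Rightarrow> bool" where
  "is_loop G e \<longleftrightarrow> e \<in> E G \<and> tail (gr G) e = head (gr G) e"

definition potential_cycle :: "('v, 'e) ograph \<Rightarrow> 'e dart set \<Rightarrow> ('v \<times> 'e dart) list \<Rightarrow> bool" where
  "potential_cycle G \<O> c \<longleftrightarrow> is_dcycle G c \<and> dcycle_darts c \<subseteq> \<O>"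


section \<open>Deletion and contraction\<close>

definition delete :: "('v, 'e) ograph \<Rightarrow> 'e set \<Rightarrow> ('v, 'e) ograph" where
  "delete G A =
     \<lparr> gr = (gr G)\<lparr> arcs := E G - A \<rparr>,
       le = Restr (le G) (E G - A) \<rparr>"

definition remove_isolated :: "('v, 'e) ograph \<Rightarrow> ('v, 'e) ograph" where
  "remove_isolated G =
     G\<lparr> gr := (gr G)\<lparr> verts := {v \<in> V G. \<exists>e\<in>E G. v = tail (gr G) e \<or> v = head (gr G) e} \<rparr> \<rparr>"

text \<open>
  The vertices of the contraction of the edge set \<open>A\<close> are the connected components of the spanning
  subgraph with edge set \<open>A\<close>. So that the contraction stays within the vertex type of \<open>G\<close>, each
  component is represented by one of its vertices. Since fourientation properties are
  invariant under isomorphism, the choice of that vertex is immaterial.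
\<close>

definition merge :: "('v, 'e) ograph \<Rightarrow> 'e set \<Rightarrow> 'v \<Rightarrow> 'v" where
  "merge G A v = (SOME w. v \<rightarrow>\<^sup>*\<^bsub>mk_symmetric ((gr G)\<lparr> arcs := A \<rparr>)\<^esub> w)"

definition contract :: "('v, 'e) ograph \<Rightarrow> 'e set \<Rightarrow> ('v, 'e) ograph" where
  "contract G A =
     \<lparr> gr = \<lparr> verts = merge G A ` V G, arcs = E G - A,
              tail = merge G A \<circ> tail (gr G), head = merge G A \<circ> head (gr G) \<rparr>,
       le = Restr (le G) (E G - A) \<rparr>"

definition cut_minor :: "('v, 'e) ograph \<Rightarrow> 'v set \<Rightarrow> ('v, 'e) ograph" where
  "cut_minor G U = contract G (E G - cut_edges G U)"

definition cycle_minor :: "('v, 'e) ograph \<Rightarrow> ('v \<times> 'e) list \<Rightarrow> ('v, 'e) ograph" where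
  "cycle_minor G c = remove_isolated (delete G (E G - cycle_edges c))"

definition restrict_fourientation :: "'e dart set \<Rightarrow> 'e set \<Rightarrow> 'e dart set" where
  "restrict_fourientation \<O> S = \<O> \<inter> (S \<times> UNIV)"


section \<open>Fourientation properties\<close>

text \<open>
  A property \<open>P\<close> takes the value \<open>good\<close> at \<open>(G, \<O>)\<close> iff \<open>P G \<O>\<close> holds. Its values at pairs that
  are not an ordered, oriented graph together with one of its fourientations are irrelevant.
  The vertex and edge types are arbitrary but fixed; deletion and contraction do not leave
  them, and with infinite types every finite graph occurs up to isomorphism.
\<close>

type_synonym ('v, 'e) property = "('v, 'e) ograph \<Rightarrow> 'e dart set \<Rightarrow> bool"

definition isomorphic ::
  "('v, 'e) ograph \<Rightarrow> 'e dart set \<Rightarrow> ('v, 'e) ograph \<Rightarrow> 'e dart set \<Rightarrow> bool" where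
  "isomorphic G \<O> H \<Q> \<longleftrightarrow>
     (\<exists>h. pre_digraph.digraph_isomorphism (gr G) h \<and> gr H = app_iso h (gr G) \<and>
        (\<forall>e\<in>E G. \<forall>f\<in>E G. (e, f) \<in> le G \<longleftrightarrow> (iso_arcs h e, iso_arcs h f) \<in> le H) \<and>
        (\<forall>e\<in>E G. \<forall>\<epsilon>. (e, \<epsilon>) \<in> \<O> \<longleftrightarrow> (iso_arcs h e, \<epsilon>) \<in> \<Q>))"

definition fourientation_property :: "('v, 'e) property \<Rightarrow> bool" where
  "fourientation_property P \<longleftrightarrow>
     (\<forall>G \<O> H \<Q>.
        ordered_oriented_graph G \<and> fourientation G \<O> \<and>
        ordered_oriented_graph H \<and> fourientation H \<Q> \<and>
        isomorphic G \<O> H \<Q> \<longrightarrow> (P G \<O> \<longleftrightarrow> P H \<Q>))"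

definition cut_property :: "('v, 'e) property \<Rightarrow> bool" where
  "cut_property P \<longleftrightarrow> fourientation_property P \<and>
     (\<forall>G \<O>. ordered_oriented_graph G \<and> fourientation G \<O> \<longrightarrow>
        (P G \<O> \<longleftrightarrow>
         (\<forall>U. simple_cut G U \<longrightarrow>
            P (cut_minor G U) (restrict_fourientation \<O> (cut_edges G U)))))"

definition cycle_property :: "('v, 'e) property \<Rightarrow> bool" where
  "cycle_property P \<longleftrightarrow> fourientation_property P \<and>
     (\<forall>G \<O>. ordered_oriented_graph G \<and> fourientation G \<O> \<longrightarrow>
        (P G \<O> \<longleftrightarrow>
         (\<forall>c. simple_cycle G c \<longrightarrow>
            P (cycle_minor G c) (restrict_fourientation \<O> (cycle_edges c)))))"

definition tutte_cut_property :: "('v, 'e) property \<Rightarrow> bool" where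
  "tutte_cut_property P \<longleftrightarrow> cut_property P \<and>
     (\<forall>G. ordered_oriented_graph G \<longrightarrow>
        (\<forall>\<O>. fourientation G \<O> \<longrightarrow> \<not> P G \<O> \<longrightarrow> (\<exists>U. potential_cut G \<O> U)) \<and>
        (\<forall>e. is_max_edge G e \<and> \<not> isthmus G e \<and> \<not> is_loop G e \<longrightarrow>
           (\<forall>\<O>. fourientation (delete G {e}) \<O> \<longrightarrow>
              (P (delete G {e}) \<O> \<longrightarrow> P G (\<O> \<union> {(e, Plus)}) \<and> P G (\<O> \<union> {(e, Minus)})) \<and>
              (\<not> P (delete G {e}) \<O> \<and> P G (\<O> \<union> {(e, Plus), (e, Minus)}) \<longrightarrow>
                 (P G (\<O> \<union> {(e, Plus)}) \<longleftrightarrow> \<not> P G (\<O> \<union> {(e, Minus)}))) \<and>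
              (P (delete G {e}) \<O> \<longleftrightarrow> P G \<O>))))"

definition tutte_cycle_property :: "('v, 'e) property \<Rightarrow> bool" where
  "tutte_cycle_property P \<longleftrightarrow> cycle_property P \<and>
     (\<forall>G. ordered_oriented_graph G \<longrightarrow>
        (\<forall>\<O>. fourientation G \<O> \<longrightarrow> \<not> P G \<O> \<longrightarrow> (\<exists>c. potential_cycle G \<O> c)) \<and>
        (\<forall>e. is_max_edge G e \<and> \<not> isthmus G e \<and> \<not> is_loop G e \<longrightarrow>
           (\<forall>\<O>. fourientation (contract G {e}) \<O> \<longrightarrow>
              (P (contract G {e}) \<O> \<longrightarrow> P G (\<O> \<union> {(e, Plus)}) \<and> P G (\<O> \<union> {(e, Minus)})) \<and>
              (\<not> P (contract G {e}) \<O> \<and> P G \<O> \<longrightarrow>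
                 (P G (\<O> \<union> {(e, Plus)}) \<longleftrightarrow> \<not> P G (\<O> \<union> {(e, Minus)}))) \<and>
              (P (contract G {e}) \<O> \<longleftrightarrow> P G (\<O> \<union> {(e, Plus), (e, Minus)})))))"


section \<open>Min-edge properties\<close>

definition bad_cut ::
  "sign set set \<Rightarrow> sign \<Rightarrow> ('v, 'e) ograph \<Rightarrow> 'e dart set \<Rightarrow> 'v set \<Rightarrow> bool" where
  "bad_cut X \<delta> G \<O> U \<longleftrightarrow>
     (let e = min_edge G (cut_edges G U) in
        edge_signs \<O> e \<in> X \<and> (unoriented \<O> e \<longrightarrow> (e, \<delta>) \<in> cut_darts G U))"

definition bad_cycle ::
  "sign set set \<Rightarrow> sign \<Rightarrow> ('v, 'e) ograph \<Rightarrow> 'e dart set \<Rightarrow> ('v \<times> 'e dart) list \<Rightarrow> bool" where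
  "bad_cycle X \<delta> G \<O> c \<longleftrightarrow>
     (let e = min_edge G (dcycle_edges c) in
        edge_signs \<O> e \<in> X \<and> (bioriented \<O> e \<longrightarrow> (e, \<delta>) \<in> dcycle_darts c))"

definition min_edge_cut_property :: "('v, 'e) property \<Rightarrow> bool" where
  "min_edge_cut_property P \<longleftrightarrow>
     (\<exists>X \<delta>. X \<subseteq> {{}, {Minus}, {Plus}} \<and>
        (\<forall>G \<O>. ordered_oriented_graph G \<and> fourientation G \<O> \<longrightarrow>
           (P G \<O> \<longleftrightarrow> (\<forall>U. potential_cut G \<O> U \<longrightarrow> \<not> bad_cut X \<delta> G \<O> U))))"

definition min_edge_cycle_property :: "('v, 'e) property \<Rightarrow> bool" where
  "min_edge_cycle_property P \<longleftrightarrow>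
     (\<exists>X \<delta>. X \<subseteq> {{Minus}, {Plus}, {Minus, Plus}} \<and>
        (\<forall>G \<O>. ordered_oriented_graph G \<and> fourientation G \<O> \<longrightarrow>
           (P G \<O> \<longleftrightarrow> (\<forall>c. potential_cycle G \<O> c \<longrightarrow> \<not> bad_cycle X \<delta> G \<O> c))))"

end

theory Submission
  imports Defs
begin

text \<open>
  A potential cut is a vertex set that no dart of \<open>\<O>\<close> enters, and this class of sets is closed under
  intersection and union. If \<open>\<O> \<union> {e\<^sup>+}\<close> and \<open>\<O> \<union> {e\<^sup>-}\<close> have bad cuts \<open>U\<close> and \<open>W\<close> that \<open>e\<close>
  leaves in opposite directions, then \<open>e\<close> crosses neither \<open>U \<inter> W\<close> nor \<open>U \<union> W\<close>, and the smaller
  of the two minimum edges crosses one of them in its old direction; that set is a bad cut for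
  \<open>\<O> \<union> {e\<^sup>+, e\<^sup>-}\<close>. The hypothesis on \<open>\<delta>\<close> excludes the one problematic case, in which both minima
  are the same unoriented edge with opposite directions.

  Dually, a bad cycle with minimum \<open>f\<close> is a walk closing \<open>f\<^sup>t\<close> along darts larger than \<open>f\<close>. If two
  such walks, for \<open>f \<le> g\<close>, use the maximum edge \<open>e\<close> in opposite directions, the one through \<open>g\<close>
  serves as a detour around \<open>e\<close> for the one through \<open>f\<close>.
\<close>

section \<open>Darts and connectivity\<close>

lemma opp_opp [simp]: "opp (opp s) = s"
  by (cases s) auto

lemma opp_neq [simp]: "opp s \<noteq> s" "s \<noteq> opp s"
  by (cases s; simp)+

lemma sign_cases: "t = s \<or> t = opp s"
  by (cases s; cases t) auto

lemma dart_opp [simp]: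
  "dart_tail G (e, opp s) = dart_head G (e, s)"
  "dart_head G (e, opp s) = dart_tail G (e, s)"
  by (cases s; simp)+

lemma in_darts_iff [simp]: "(e, s) \<in> darts G \<longleftrightarrow> e \<in> E G"
  by (auto simp: darts_def)

lemma all_sign: "(\<forall>s. Q s) \<longleftrightarrow> Q Plus \<and> Q Minus"
  using sign.exhaust by metis

lemma edge_signs_empty_iff: "edge_signs \<O> e = {} \<longleftrightarrow> unoriented \<O> e"
  by (simp add: edge_signs_def unoriented_def all_sign)

lemma edge_signs_UNIV_iff: "edge_signs \<O> e = UNIV \<longleftrightarrow> bioriented \<O> e"
  by (simp add: edge_signs_def bioriented_def set_eq_iff all_sign)

lemma edge_signs_restrict:
  "e \<in> S \<Longrightarrow> edge_signs (restrict_fourientation \<O> S) e = edge_signs \<O> e"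
  by (auto simp: edge_signs_def restrict_fourientation_def)

lemma oog_fin: "ordered_oriented_graph G \<Longrightarrow> fin_digraph (gr G)"
  by (simp add: ordered_oriented_graph_def)

lemma oog_wf: "ordered_oriented_graph G \<Longrightarrow> wf_digraph (gr G)"
  using oog_fin fin_digraph_def by blast

lemma dart_in_verts:
  assumes "wf_digraph (gr G)" "d \<in> darts G"
  shows "dart_tail G d \<in> V G" "dart_head G d \<in> V G"
proof -
  obtain e s where d: "d = (e, s)" by (cases d)
  show "dart_tail G d \<in> V G" "dart_head G d \<in> V G"
    using assms wf_digraph.wellformed[OF assms(1)] unfolding d by (cases s; simp)+
qed

lemma cut_edges_iff_dart:
  "e \<in> cut_edges G U \<longleftrightarrow> (\<exists>s. (e, s) \<in> cut_darts G U)"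
proof
  assume "e \<in> cut_edges G U"
  then have "(e, Plus) \<in> cut_darts G U \<or> (e, Minus) \<in> cut_darts G U"
    by (auto simp: cut_edges_def cut_darts_def)
  then show "\<exists>s. (e, s) \<in> cut_darts G U" by blast
next
  assume "\<exists>s. (e, s) \<in> cut_darts G U"
  then obtain s where "(e, s) \<in> cut_darts G U" by blast
  then show "e \<in> cut_edges G U" by (cases s) (auto simp: cut_edges_def cut_darts_def)
qed

lemma cut_edges_iff:
  assumes "wf_digraph (gr G)" "U \<subseteq> V G"
  shows "e \<in> cut_edges G U \<longleftrightarrow> e \<in> E G \<and> (dart_tail G (e, s) \<in> U \<longleftrightarrow> dart_head G (e, s) \<notin> U)"
  using assms(2) wf_digraph.wellformed[OF assms(1), of e] by (cases s) (auto simp: cut_edges_def)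

lemma cut_darts_iff:
  assumes "wf_digraph (gr G)"
  shows "d \<in> cut_darts G U \<longleftrightarrow> d \<in> darts G \<and> dart_tail G d \<in> U \<and> dart_head G d \<notin> U"
  using dart_in_verts(2)[OF assms, of d] by (auto simp: cut_darts_def)

section \<open>Connectivity expressed through cuts\<close>

lemma reachable_mk_symmetric_closed:
  assumes "u \<rightarrow>\<^sup>*\<^bsub>mk_symmetric H\<^esub> v" "u \<in> U"
    and "\<And>e. e \<in> arcs H \<Longrightarrow> tail H e \<in> U \<longleftrightarrow> head H e \<in> U"
  shows "v \<in> U"
  using assms(1) unfolding reachable_def
  by (induct rule: rtrancl_on_induct) (use assms(2,3) in \<open>auto simp: parcs_mk_symmetric\<close>)

text \<open>Connectivity is turned into a condition on vertex sets, so that for deletions, minors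
  and the two sides of a cut it can be checked on cuts instead of by constructing walks.\<close>

lemma connected_iff_cut:
  assumes "wf_digraph H"
  shows "Digraph_Component.connected H \<longleftrightarrow> verts H \<noteq> {} \<and>
    (\<forall>U. U \<subseteq> verts H \<and> U \<noteq> {} \<and> (\<forall>e\<in>arcs H. tail H e \<in> U \<longleftrightarrow> head H e \<in> U) \<longrightarrow> U = verts H)"
    (is "?C \<longleftrightarrow> _ \<and> (\<forall>U. ?P U \<longrightarrow> _)")
proof
  assume ?C
  then have ne: "verts H \<noteq> {}"
    and reach: "\<And>u v. u \<in> verts H \<Longrightarrow> v \<in> verts H \<Longrightarrow> u \<rightarrow>\<^sup>*\<^bsub>mk_symmetric H\<^esub> v"
    by (auto simp: connected_def strongly_connected_def)
  have "v \<in> U" if U: "?P U" and v: "v \<in> verts H" for U v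
  proof -
    from U obtain u where u: "u \<in> U" by blast
    show ?thesis using reachable_mk_symmetric_closed[OF reach u] u U v by blast
  qed
  then show "verts H \<noteq> {} \<and> (\<forall>U. ?P U \<longrightarrow> U = verts H)" using ne by blast
next
  assume "verts H \<noteq> {} \<and> (\<forall>U. ?P U \<longrightarrow> U = verts H)"
  then have ne: "verts H \<noteq> {}" and cut: "\<forall>U. ?P U \<longrightarrow> U = verts H" by auto
  have "u \<rightarrow>\<^sup>*\<^bsub>mk_symmetric H\<^esub> v" if u: "u \<in> verts H" and v: "v \<in> verts H" for u v
  proof -
    \<comment> \<open>The component of \<open>u\<close> is crossed by no edge, so by hypothesis it
      is everything.\<close>
    let ?U = "{x \<in> verts H. u \<rightarrow>\<^sup>*\<^bsub>mk_symmetric H\<^esub> x}"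
    have "tail H e \<in> ?U \<longleftrightarrow> head H e \<in> ?U" if "e \<in> arcs H" for e
    proof -
      have "(tail H e, head H e) \<in> parcs (mk_symmetric H)" "(head H e, tail H e) \<in> parcs (mk_symmetric H)"
        using that by (auto simp: parcs_mk_symmetric)
      then show ?thesis
        using that assms unfolding reachable_def
        by (auto intro: rtrancl_on_into_rtrancl_on simp: wf_digraph_def)
    qed
    moreover have "u \<in> ?U" using u by (auto simp: reachable_def)
    ultimately have "?U = verts H" by (intro cut[rule_format] conjI) blast+
    then show ?thesis using v by blast
  qed
  then show ?C using ne by (simp add: connected_def strongly_connected_def)
qed

lemma connected_iff_cut_edges:
  assumes "wf_digraph (gr G)"
  shows "Digraph_Component.connected (gr G) \<longleftrightarrow>
    V G \<noteq> {} \<and> (\<forall>U. is_cut G U \<longrightarrow> cut_edges G U \<noteq> {})"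
proof -
  have "(is_cut G U \<longrightarrow> cut_edges G U \<noteq> {}) \<longleftrightarrow>
      (U \<subseteq> V G \<and> U \<noteq> {} \<and> (\<forall>e\<in>E G. tail (gr G) e \<in> U \<longleftrightarrow> head (gr G) e \<in> U) \<longrightarrow> U = V G)" for U
    using wf_digraph.wellformed[OF assms] by (auto simp: cut_edges_def is_cut_def)
  then show ?thesis
    unfolding connected_iff_cut[OF assms] by simp
qed

lemma oogI:
  assumes "fin_digraph (gr G)" "V G \<noteq> {}" "\<And>U. is_cut G U \<Longrightarrow> cut_edges G U \<noteq> {}"
    "linear_order_on (E G) (le G)"
  shows "ordered_oriented_graph G"
  using assms connected_iff_cut_edges[of G] fin_digraph.axioms(1)[OF assms(1)]
  by (simp add: ordered_oriented_graph_def)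

lemma oog_cut_edges:
  assumes "ordered_oriented_graph G" "is_cut G U"
  shows "cut_edges G U \<noteq> {}"
  using assms connected_iff_cut_edges[OF oog_wf[OF assms(1)]]
  by (simp add: ordered_oriented_graph_def)

section \<open>The edge order and its minima\<close>

lemma oog_le_refl: "ordered_oriented_graph G \<Longrightarrow> e \<in> E G \<Longrightarrow> (e, e) \<in> le G"
  by (auto simp: ordered_oriented_graph_def order_on_defs refl_on_def)

lemma oog_le_total:
  "ordered_oriented_graph G \<Longrightarrow> e \<in> E G \<Longrightarrow> f \<in> E G \<Longrightarrow> (e, f) \<in> le G \<or> (f, e) \<in> le G"
  using oog_le_refl[of G e] by (auto simp: ordered_oriented_graph_def order_on_defs total_on_def)

lemma oog_le_antisym:
  "ordered_oriented_graph G \<Longrightarrow> (e, f) \<in> le G \<Longrightarrow> (f, e) \<in> le G \<Longrightarrow> e = f"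
  by (auto simp: ordered_oriented_graph_def order_on_defs antisym_def)

lemma oog_le_trans:
  "ordered_oriented_graph G \<Longrightarrow> (e, f) \<in> le G \<Longrightarrow> (f, g) \<in> le G \<Longrightarrow> (e, g) \<in> le G"
  by (auto simp: ordered_oriented_graph_def order_on_defs dest: transD)

lemma ex_is_min_edge:
  assumes G: "ordered_oriented_graph G" and S: "S \<subseteq> E G" "S \<noteq> {}"
  shows "\<exists>e. is_min_edge G S e"
proof -
  have "finite S" using S oog_fin[OF G] by (meson fin_digraph.finite_arcs finite_subset)
  then show ?thesis using S(2,1)
  proof (induct rule: finite_ne_induct)
    case (singleton x)
    then show ?case using oog_le_refl[OF G] by (auto simp: is_min_edge_def)
  next
    case (insert x F)
    then obtain m where m: "is_min_edge G F m" by auto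
    then have mx: "m \<in> F" "\<forall>f\<in>F. (m, f) \<in> le G" by (auto simp: is_min_edge_def)
    show ?case
    proof (cases "(m, x) \<in> le G")
      case True
      then show ?thesis using mx by (auto simp: is_min_edge_def)
    next
      case False
      then have "(x, m) \<in> le G" using oog_le_total[OF G] insert.prems mx by blast
      then have "is_min_edge G (insert x F) x"
        using mx insert.prems oog_le_refl[OF G] oog_le_trans[OF G] by (auto simp: is_min_edge_def)
      then show ?thesis ..
    qed
  qed
qed

lemma min_edge_eq:
  assumes "ordered_oriented_graph G" "is_min_edge G S e"
  shows "min_edge G S = e"
  unfolding min_edge_def
  using assms oog_le_antisym[OF assms(1)] by (intro the_equality) (auto simp: is_min_edge_def)

lemma linear_order_on_Restr:
  assumes "linear_order_on A r" "B \<subseteq> A"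
  shows "linear_order_on B (Restr r B)"
proof -
  have "refl_on A r" "trans r" "antisym r" and total: "total_on A r"
    using assms(1) by (auto simp: order_on_defs)
  then have "refl_on B (Restr r B)" "trans (Restr r B)" "antisym (Restr r B)"
    using assms(2) by (auto simp: refl_on_def antisym_def intro: trans_Restr)
  moreover have "total_on B (Restr r B)"
    using total_on_subset[OF total assms(2)] by (auto simp: total_on_def)
  ultimately show ?thesis by (simp add: order_on_defs)
qed

lemma is_max_edge_not_min:
  assumes G: "ordered_oriented_graph G" and e: "is_max_edge G e"
    and S: "is_min_edge G S f" "g \<in> S" "g \<noteq> e" "g \<in> E G"
  shows "f \<noteq> e"
proof
  assume "f = e"
  then have "(e, g) \<in> le G" "(g, e) \<in> le G"
    using assms by (auto simp: is_min_edge_def is_max_edge_def)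
  then show False using oog_le_antisym[OF G] S(3) by blast
qed

section \<open>Deletion and contraction\<close>

lemma delete_simps [simp]:
  "verts (gr (delete G A)) = V G" "arcs (gr (delete G A)) = E G - A"
  "tail (gr (delete G A)) = tail (gr G)" "head (gr (delete G A)) = head (gr G)"
  "le (delete G A) = Restr (le G) (E G - A)"
  by (simp_all add: delete_def)

lemma dart_ends_delete [simp]:
  "dart_tail (delete G A) d = dart_tail G d" "dart_head (delete G A) d = dart_head G d"
  by (cases d; cases "snd d"; simp)+

lemma cut_edges_delete: "cut_edges (delete G A) U = cut_edges G U - A"
  by (auto simp: cut_edges_def)

text \<open>A cut without edges after the deletion would have had at most the edge \<open>e\<close>
  before: connectivity excludes the empty set, and \<open>e\<close> being no isthmus excludes
  \<open>{e}\<close>.\<close>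

lemma oog_delete:
  assumes G: "ordered_oriented_graph G" and e: "\<not> isthmus G e"
  shows "ordered_oriented_graph (delete G {e})"
proof (rule oogI)
  show "fin_digraph (gr (delete G {e}))"
    using fin_digraph.finite_verts[OF oog_fin[OF G]] fin_digraph.finite_arcs[OF oog_fin[OF G]]
      wf_digraph.wellformed[OF oog_wf[OF G]]
    by unfold_locales simp_all
  show "V (delete G {e}) \<noteq> {}"
    using G by (auto simp: ordered_oriented_graph_def connected_def strongly_connected_def)
  show "cut_edges (delete G {e}) U \<noteq> {}" if "is_cut (delete G {e}) U" for U
  proof -
    have "is_cut G U" using that by (simp add: is_cut_def)
    then have "cut_edges G U \<noteq> {e}" "cut_edges G U \<noteq> {}"
      using e oog_cut_edges[OF G] by (auto simp: isthmus_def)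
    then show ?thesis by (auto simp: cut_edges_delete)
  qed
  show "linear_order_on (E (delete G {e})) (le (delete G {e}))"
    using G by (auto simp: ordered_oriented_graph_def intro: linear_order_on_Restr)
qed

section \<open>Walks along darts, and their behaviour under contraction\<close>

definition steps :: "('v, 'e) ograph \<Rightarrow> 'e dart set \<Rightarrow> 'v rel" where
  "steps G D = (\<lambda>d. (dart_tail G d, dart_head G d)) ` D"

lemma steps_mono: "D \<subseteq> D' \<Longrightarrow> steps G D \<subseteq> steps G D'"
  by (auto simp: steps_def)

lemma sym_steps: "sym (steps G (A \<times> UNIV))"
  unfolding steps_def
proof (rule symI)
  fix a b assume "(a, b) \<in> (\<lambda>d. (dart_tail G d, dart_head G d)) ` (A \<times> UNIV)"
  then obtain e s where "e \<in> A" "a = dart_tail G (e, s)" "b = dart_head G (e, s)" by auto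
  then have "(e, opp s) \<in> A \<times> UNIV" "(b, a) = (dart_tail G (e, opp s), dart_head G (e, opp s))" by auto
  then show "(b, a) \<in> (\<lambda>d. (dart_tail G d, dart_head G d)) ` (A \<times> UNIV)" by blast
qed

lemma merge_related:
  assumes "wf_digraph (gr G)" "A \<subseteq> E G" "v \<in> V G"
  shows "merge G A v \<in> V G" "(v, merge G A v) \<in> (steps G (A \<times> UNIV))\<^sup>*"
proof -
  let ?H = "mk_symmetric ((gr G)\<lparr> arcs := A \<rparr>)"
  \<comment> \<open>Reflexivity supplies a witness for the choice in \<open>merge\<close>.\<close>
  have "v \<rightarrow>\<^sup>*\<^bsub>?H\<^esub> v" using assms(3) by (auto simp: reachable_def)
  then have r: "v \<rightarrow>\<^sup>*\<^bsub>?H\<^esub> merge G A v" unfolding merge_def by (rule someI)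
  then show "merge G A v \<in> V G" by (auto elim: reachable_in_vertsE)
  have "parcs ?H \<subseteq> steps G (A \<times> UNIV)"
  proof
    fix p assume "p \<in> parcs ?H"
    then obtain e where e: "e \<in> A" "p = (tail (gr G) e, head (gr G) e) \<or> p = (head (gr G) e, tail (gr G) e)"
      by (auto simp: parcs_mk_symmetric)
    then have "p = (dart_tail G (e, Plus), dart_head G (e, Plus)) \<or> p = (dart_tail G (e, Minus), dart_head G (e, Minus))"
      by simp
    then show "p \<in> steps G (A \<times> UNIV)" using e(1) unfolding steps_def by blast
  qed
  then show "(v, merge G A v) \<in> (steps G (A \<times> UNIV))\<^sup>*"
    using rtrancl_mono rtrancl_on_rtranclI[of v "merge G A v"] r unfolding reachable_def with_proj_simps by blast
qed

lemma merge_dart_eq: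
  assumes wf: "wf_digraph (gr G)" and A: "A \<subseteq> E G" and d: "fst d \<in> A"
  shows "merge G A (dart_tail G d) = merge G A (dart_head G d)"
proof -
  let ?H = "mk_symmetric ((gr G)\<lparr> arcs := A \<rparr>)"
  obtain e s where es: "d = (e, s)" "e \<in> A" using d by (cases d) auto
  let ?u = "dart_tail G d" and ?v = "dart_head G d"
  have uv: "?u \<in> V G" "?v \<in> V G" using dart_in_verts[OF wf, of d] es A by auto
  have "(?u, ?v) \<in> parcs ?H" "(?v, ?u) \<in> parcs ?H"
    using es by (cases s; force simp: parcs_mk_symmetric)+
  then have "(?u, ?v) \<in> rtrancl_on (pverts ?H) (parcs ?H)" "(?v, ?u) \<in> rtrancl_on (pverts ?H) (parcs ?H)"
    using uv by (auto intro: rtrancl_on_into_rtrancl_on)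
  \<comment> \<open>Both ends of the dart reach the same vertices, so the two choices are made from
    the same predicate and agree.\<close>
  then have "?u \<rightarrow>\<^sup>*\<^bsub>?H\<^esub> w \<longleftrightarrow> ?v \<rightarrow>\<^sup>*\<^bsub>?H\<^esub> w" for w
    unfolding reachable_def by (auto intro: rtrancl_on_trans)
  then show ?thesis by (simp add: merge_def)
qed

lemma contract_simps [simp]:
  "verts (gr (contract G A)) = merge G A ` V G" "arcs (gr (contract G A)) = E G - A"
  "le (contract G A) = Restr (le G) (E G - A)"
  by (simp_all add: contract_def)

lemma dart_ends_contract [simp]:
  "dart_tail (contract G A) d = merge G A (dart_tail G d)"
  "dart_head (contract G A) d = merge G A (dart_head G d)"
  by (cases d; cases "snd d"; simp add: contract_def)+

lemma darts_contract: "d \<in> darts (contract G A) \<longleftrightarrow> d \<in> darts G \<and> fst d \<notin> A"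
  by (cases d) auto

lemma wf_contract:
  assumes "wf_digraph (gr G)"
  shows "wf_digraph (gr (contract G A))"
  using wf_digraph.wellformed[OF assms] by unfold_locales (simp_all add: contract_def)

text \<open>Pulling a cut of the contraction back to \<open>G\<close> gives a cut that no edge of
  \<open>A\<close> crosses; through \<open>cut_preimage_image\<close>, all such cuts arise in this
  way.\<close>

definition cut_preimage :: "('v, 'e) ograph \<Rightarrow> 'e set \<Rightarrow> 'v set \<Rightarrow> 'v set" where
  "cut_preimage G A W = {v \<in> V G. merge G A v \<in> W}"

lemma cut_preimage_subset: "cut_preimage G A W \<subseteq> V G"
  by (auto simp: cut_preimage_def)

text \<open>The ends of a dart over \<open>A\<close> are merged, so they lie on the same side of a
  preimage; all other darts survive the contraction.\<close>

lemma cut_darts_preimage: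
  assumes wf: "wf_digraph (gr G)" and A: "A \<subseteq> E G"
  shows "cut_darts G (cut_preimage G A W) = cut_darts (contract G A) W"
proof -
  have "d \<in> cut_darts G (cut_preimage G A W) \<longleftrightarrow> d \<in> cut_darts (contract G A) W" for d
    using dart_in_verts[OF wf, of d] merge_dart_eq[OF wf A, of d]
    by (auto simp: cut_darts_iff[OF wf] cut_darts_iff[OF wf_contract[OF wf]] darts_contract cut_preimage_def)
  then show ?thesis by blast
qed

lemma cut_edges_preimage:
  assumes "wf_digraph (gr G)" "A \<subseteq> E G"
  shows "cut_edges G (cut_preimage G A W) = cut_edges (contract G A) W"
  using cut_darts_preimage[OF assms] by (auto simp: cut_edges_iff_dart)

lemma is_cut_preimage:
  assumes "is_cut (contract G A) W"
  shows "is_cut G (cut_preimage G A W)"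
  using assms by (fastforce simp: is_cut_def cut_preimage_def)

lemma oog_contract:
  assumes G: "ordered_oriented_graph G" and A: "A \<subseteq> E G"
  shows "ordered_oriented_graph (contract G A)"
proof (rule oogI)
  note wf = oog_wf[OF G]
  show "fin_digraph (gr (contract G A))"
    using fin_digraph.finite_verts[OF oog_fin[OF G]] fin_digraph.finite_arcs[OF oog_fin[OF G]]
      wf_contract[OF wf]
    by (simp add: fin_digraph_def fin_digraph_axioms_def)
  show "V (contract G A) \<noteq> {}"
    using G by (auto simp: ordered_oriented_graph_def connected_def strongly_connected_def)
  show "cut_edges (contract G A) W \<noteq> {}" if "is_cut (contract G A) W" for W
    using oog_cut_edges[OF G is_cut_preimage[OF that]] cut_edges_preimage[OF wf A] by simp
  show "linear_order_on (E (contract G A)) (le (contract G A))"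
    using G by (auto simp: ordered_oriented_graph_def intro: linear_order_on_Restr)
qed

text \<open>A set crossed by no edge of \<open>A\<close> is a union of components of the subgraph
  with edge set \<open>A\<close>, so merging loses no information about membership.\<close>

lemma merge_in_image_iff:
  assumes wf: "wf_digraph (gr G)" and A: "A \<subseteq> E G" and U: "U \<subseteq> V G" "cut_edges G U \<inter> A = {}"
    and v: "v \<in> V G"
  shows "merge G A v \<in> merge G A ` U \<longleftrightarrow> v \<in> U"
proof -
  have closed: "x \<in> U \<longleftrightarrow> y \<in> U" if "(x, y) \<in> (steps G (A \<times> UNIV))\<^sup>*" for x y
    using that
  proof (induct rule: rtrancl_induct)
    case (step y z)
    then obtain e s where es: "e \<in> A" "y = dart_tail G (e, s)" "z = dart_head G (e, s)"
      by (auto simp: steps_def)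
    then have "e \<notin> cut_edges G U" "e \<in> E G" using U A by auto
    then show ?case using step es cut_edges_iff[OF wf U(1), of e s] by blast
  qed simp
  have "merge G A x \<in> U \<longleftrightarrow> x \<in> U" if "x \<in> V G" for x
    using closed[OF merge_related(2)[OF wf A that]] by blast
  then show ?thesis using v U(1) by (metis image_eqI image_iff subsetD)
qed

lemma cut_preimage_image:
  assumes "wf_digraph (gr G)" "A \<subseteq> E G" "U \<subseteq> V G" "cut_edges G U \<inter> A = {}"
  shows "cut_preimage G A (merge G A ` U) = U"
  using merge_in_image_iff[OF assms] assms(3) by (auto simp: cut_preimage_def)

text \<open>Directed walks in a contraction lift to \<open>G\<close> once the edges of
  \<open>A\<close> may be used in both directions: consecutive darts of the walk meet in a merged
  vertex, and the gap between their ends in \<open>G\<close> is filled by a walk in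
  \<open>A\<close>.\<close>

lemma steps_contract_iff:
  assumes wf: "wf_digraph (gr G)" and A: "A \<subseteq> E G" and D: "D \<subseteq> darts G"
    and u: "u \<in> V G" and v: "v \<in> V G"
  shows "(merge G A u, merge G A v) \<in> (steps (contract G A) D)\<^sup>* \<longleftrightarrow>
    (u, v) \<in> (steps G (D \<union> A \<times> UNIV))\<^sup>*"
proof
  let ?S = "steps G (D \<union> A \<times> UNIV)"
  have related: "(x, y) \<in> ?S\<^sup>*" if "merge G A x = merge G A y" "x \<in> V G" "y \<in> V G" for x y
  proof -
    have "(x, merge G A x) \<in> (steps G (A \<times> UNIV))\<^sup>*" "(merge G A x, y) \<in> (steps G (A \<times> UNIV))\<^sup>*"
      using merge_related(2)[OF wf A that(2)] merge_related(2)[OF wf A that(3)] that(1)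
        symD[OF sym_rtrancl[OF sym_steps]] by auto
    moreover have "(steps G (A \<times> UNIV))\<^sup>* \<subseteq> ?S\<^sup>*" by (intro rtrancl_mono steps_mono) blast
    ultimately show ?thesis by (meson rtrancl_trans subsetD)
  qed
  \<comment> \<open>A vertex of the contraction stands for a whole class, so the induction carries
    the claim for every vertex of the class.\<close>
  have "\<forall>y\<in>V G. merge G A y = b \<longrightarrow> (u, y) \<in> ?S\<^sup>*"
    if "(merge G A u, b) \<in> (steps (contract G A) D)\<^sup>*" for b
    using that
  proof (induct rule: rtrancl_induct)
    case base
    then show ?case using related u by metis
  next
    case (step b c)
    then obtain d where d: "d \<in> D" "b = merge G A (dart_tail G d)" "c = merge G A (dart_head G d)"
      by (auto simp: steps_def)
    have dV: "dart_tail G d \<in> V G" "dart_head G d \<in> V G" using dart_in_verts[OF wf, of d] d(1) D by blast+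
    have "(u, dart_tail G d) \<in> ?S\<^sup>*" using step(3) d dV by blast
    moreover have "(dart_tail G d, dart_head G d) \<in> ?S" using d by (auto simp: steps_def)
    ultimately have "(u, dart_head G d) \<in> ?S\<^sup>*" by simp
    then show ?case using related[OF _ dV(2)] d(3) rtrancl_trans by metis
  qed
  then show "(merge G A u, merge G A v) \<in> (steps (contract G A) D)\<^sup>* \<Longrightarrow> (u, v) \<in> ?S\<^sup>*"
    using v by blast
next
  assume "(u, v) \<in> (steps G (D \<union> A \<times> UNIV))\<^sup>*"
  then show "(merge G A u, merge G A v) \<in> (steps (contract G A) D)\<^sup>*"
  proof (induct rule: rtrancl_induct)
    case (step y z)
    then obtain d where "d \<in> D \<union> A \<times> UNIV" and d: "y = dart_tail G d" "z = dart_head G d"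
      by (auto simp: steps_def)
    then have "d \<in> D \<or> fst d \<in> A" by auto
    with d have "merge G A y = merge G A z \<or> (merge G A y, merge G A z) \<in> steps (contract G A) D"
      using merge_dart_eq[OF wf A, of d] by (auto simp: steps_def)
    then show ?case using step(3) by (auto intro: rtrancl_into_rtrancl)
  qed simp
qed

section \<open>Isomorphisms\<close>

text \<open>Thanks to symmetry, bad cuts and bad cycles have to be transported along an isomorphism
  in one direction only.\<close>

lemma isomorphic_sym:
  assumes G: "ordered_oriented_graph G" and H: "ordered_oriented_graph H"
    and iso: "isomorphic G \<O> H \<Q>"
  shows "isomorphic H \<Q> G \<O>"
proof -
  obtain h where h: "pre_digraph.digraph_isomorphism (gr G) h" and app: "gr H = app_iso h (gr G)"
    and le: "\<forall>e\<in>E G. \<forall>f\<in>E G. (e, f) \<in> le G \<longleftrightarrow> (iso_arcs h e, iso_arcs h f) \<in> le H"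
    and or: "\<forall>e\<in>E G. \<forall>s. (e, s) \<in> \<O> \<longleftrightarrow> (iso_arcs h e, s) \<in> \<Q>"
    using iso unfolding isomorphic_def by blast
  let ?k = "pre_digraph.inv_iso (gr G) h"
  have 1: "pre_digraph.digraph_isomorphism (gr H) ?k"
    unfolding app using wf_digraph.digraph_isomorphism_invI[OF oog_wf[OF G] h] .
  have 2: "gr G = app_iso ?k (gr H)"
    unfolding app using pre_digraph.app_iso_inv[OF h] by simp
  have inv: "iso_arcs h (iso_arcs ?k e) = e" "iso_arcs ?k e \<in> E G" if "e \<in> E H" for e
    using that pre_digraph.iso_arcs_iso_inv[OF h] pre_digraph.iso_arcs_inv_iso[OF h]
    unfolding app by auto
  have 3: "\<forall>e\<in>E H. \<forall>f\<in>E H. (e, f) \<in> le H \<longleftrightarrow> (iso_arcs ?k e, iso_arcs ?k f) \<in> le G"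
    using le inv by simp
  have 4: "\<forall>e\<in>E H. \<forall>s. (e, s) \<in> \<Q> \<longleftrightarrow> (iso_arcs ?k e, s) \<in> \<O>"
    using or inv by simp
  show ?thesis unfolding isomorphic_def using 1 2 3 4 by blast
qed

lemma isomorphicE:
  assumes "isomorphic G \<O> H \<Q>"
  obtains p q where "inj_on p (V G)" "V H = p ` V G" "E H = q ` E G"
    "\<And>e f. e \<in> E G \<Longrightarrow> f \<in> E G \<Longrightarrow> (q e, q f) \<in> le H \<longleftrightarrow> (e, f) \<in> le G"
    "\<And>e s. e \<in> E G \<Longrightarrow> (q e, s) \<in> \<Q> \<longleftrightarrow> (e, s) \<in> \<O>"
    "\<And>e s. e \<in> E G \<Longrightarrow> dart_tail H (q e, s) = p (dart_tail G (e, s))"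
    "\<And>e s. e \<in> E G \<Longrightarrow> dart_head H (q e, s) = p (dart_head G (e, s))"
proof -
  obtain h where h: "pre_digraph.digraph_isomorphism (gr G) h" and app: "gr H = app_iso h (gr G)"
    and le: "\<forall>e\<in>E G. \<forall>f\<in>E G. (e, f) \<in> le G \<longleftrightarrow> (iso_arcs h e, iso_arcs h f) \<in> le H"
    and or: "\<forall>e\<in>E G. \<forall>s. (e, s) \<in> \<O> \<longleftrightarrow> (iso_arcs h e, s) \<in> \<Q>"
    using assms unfolding isomorphic_def by blast
  have tl: "dart_tail H (iso_arcs h e, s) = iso_verts h (dart_tail G (e, s))" if "e \<in> E G" for e s
    using that pre_digraph.iso_verts_tail[OF h] pre_digraph.iso_verts_head[OF h]
    by (cases s) (auto simp: app)
  have hd: "dart_head H (iso_arcs h e, s) = iso_verts h (dart_head G (e, s))" if "e \<in> E G" for e s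
    using tl[OF that, of "opp s"] by simp
  show thesis
  proof (rule that)
    show "inj_on (iso_verts h) (V G)" using pre_digraph.digraph_isomorphism_inj_on_verts[OF h] .
    show "V H = iso_verts h ` V G" "E H = iso_arcs h ` E G" by (simp_all add: app)
  qed (use le or tl hd in auto)
qed

section \<open>Min-edge cut properties\<close>

text \<open>With \<open>\<O> \<subseteq> darts G\<close>, this says that \<open>U\<close> is a bad potential cut of \<open>\<O>\<close> whose minimum
  edge \<open>e\<close> is directed as \<open>e\<^sup>s\<close> in it: potential cuts are those that no dart of \<open>\<O>\<close> enters.\<close>

definition bad_cut_at ::
  "sign set set \<Rightarrow> sign \<Rightarrow> ('v, 'e) ograph \<Rightarrow> 'e dart set \<Rightarrow> 'v set \<Rightarrow> 'e \<Rightarrow> sign \<Rightarrow> bool" where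
  "bad_cut_at X \<delta> G \<O> U e s \<longleftrightarrow> U \<subseteq> V G \<and> (e, s) \<in> cut_darts G U \<and>
     (\<forall>d\<in>\<O>. dart_head G d \<in> U \<longrightarrow> dart_tail G d \<in> U) \<and> (\<forall>f\<in>cut_edges G U. (e, f) \<in> le G) \<and>
     edge_signs \<O> e \<in> X \<and> (unoriented \<O> e \<longrightarrow> s = \<delta>)"

lemma is_cutI:
  assumes "U \<subseteq> V G" "d \<in> cut_darts G U"
  shows "is_cut G U"
  using assms by (auto simp: is_cut_def cut_darts_def)

text \<open>The opposite of a dart leaving \<open>U\<close> is a dart entering \<open>U\<close>. In
  the form without \<open>opp\<close>, closure under intersection and union is immediate.\<close>

lemma potential_cut_iff:
  assumes wf: "wf_digraph (gr G)" and \<O>: "fourientation G \<O>"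
  shows "potential_cut G \<O> U \<longleftrightarrow>
    is_cut G U \<and> (\<forall>d\<in>\<O>. dart_head G d \<in> U \<longrightarrow> dart_tail G d \<in> U)"
proof -
  have "(\<forall>e s. (e, s) \<in> cut_darts G U \<longrightarrow> (e, opp s) \<notin> \<O>) \<longleftrightarrow>
      (\<forall>e s. (e, s) \<in> \<O> \<longrightarrow> (e, opp s) \<notin> cut_darts G U)"
    by (metis opp_opp)
  also have "\<dots> \<longleftrightarrow> (\<forall>d\<in>\<O>. dart_head G d \<in> U \<longrightarrow> dart_tail G d \<in> U)"
    using \<O> by (fastforce simp: fourientation_def cut_darts_iff[OF wf] darts_def)
  finally show ?thesis by (simp add: potential_cut_def)
qed

text \<open>The minimum edge and its direction become explicit witnesses, which frees the later
  arguments from the definite description in \<open>min_edge\<close>.\<close>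

lemma ex_bad_cut_iff:
  assumes G: "ordered_oriented_graph G" and \<O>: "fourientation G \<O>"
  shows "(\<exists>U. potential_cut G \<O> U \<and> bad_cut X \<delta> G \<O> U) \<longleftrightarrow> (\<exists>U e s. bad_cut_at X \<delta> G \<O> U e s)"
proof
  note wf = oog_wf[OF G]
  assume "\<exists>U. potential_cut G \<O> U \<and> bad_cut X \<delta> G \<O> U"
  then obtain U where U: "potential_cut G \<O> U" "bad_cut X \<delta> G \<O> U" by blast
  then have cut: "is_cut G U" by (simp add: potential_cut_def)
  have "cut_edges G U \<subseteq> E G" by (auto simp: cut_edges_def)
  then obtain e where e: "is_min_edge G (cut_edges G U) e"
    using ex_is_min_edge[OF G] oog_cut_edges[OF G cut] by blast
  have bad: "edge_signs \<O> e \<in> X" "unoriented \<O> e \<Longrightarrow> (e, \<delta>) \<in> cut_darts G U"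
    using U(2) min_edge_eq[OF G e] by (auto simp: bad_cut_def Let_def)
  \<comment> \<open>For an unoriented minimum the direction is prescribed by \<delta>; otherwise any
    direction in which \<open>e\<close> crosses the cut will do.\<close>
  obtain s where s: "(e, s) \<in> cut_darts G U" "unoriented \<O> e \<Longrightarrow> s = \<delta>"
  proof (cases "unoriented \<O> e")
    case True
    then show thesis using that bad(2) by blast
  next
    case False
    then show thesis using that e by (auto simp: is_min_edge_def cut_edges_iff_dart)
  qed
  then have "bad_cut_at X \<delta> G \<O> U e s"
    using U(1) e bad(1) cut unfolding bad_cut_at_def potential_cut_iff[OF wf \<O>]
    by (auto simp: is_min_edge_def is_cut_def)
  then show "\<exists>U e s. bad_cut_at X \<delta> G \<O> U e s" by blast
next
  note wf = oog_wf[OF G]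
  assume "\<exists>U e s. bad_cut_at X \<delta> G \<O> U e s"
  then obtain U e s where U: "bad_cut_at X \<delta> G \<O> U e s" by blast
  then have es: "(e, s) \<in> cut_darts G U" and "U \<subseteq> V G" by (auto simp: bad_cut_at_def)
  then have cut: "is_cut G U" by (rule is_cutI[rotated])
  have "is_min_edge G (cut_edges G U) e"
    using U es by (auto simp: is_min_edge_def bad_cut_at_def cut_edges_iff_dart)
  then have "bad_cut X \<delta> G \<O> U"
    using U es min_edge_eq[OF G] unfolding bad_cut_def by (auto simp: bad_cut_at_def Let_def)
  moreover have "potential_cut G \<O> U"
    using U cut unfolding potential_cut_iff[OF wf \<O>] by (simp add: bad_cut_at_def)
  ultimately show "\<exists>U. potential_cut G \<O> U \<and> bad_cut X \<delta> G \<O> U" by blast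
qed

section \<open>Bad cuts under isomorphism and contraction\<close>

lemma bad_cut_at_isomorphic:
  assumes G: "ordered_oriented_graph G" and H: "ordered_oriented_graph H"
    and \<Q>: "fourientation H \<Q>"
    and iso: "isomorphic G \<O> H \<Q>" and bad: "bad_cut_at X \<delta> G \<O> U e s"
  shows "\<exists>W f. bad_cut_at X \<delta> H \<Q> W f s"
proof -
  note wfG = oog_wf[OF G] and wfH = oog_wf[OF H]
  obtain p q where inj: "inj_on p (V G)" and VH: "V H = p ` V G" and EH: "E H = q ` E G"
    and le: "\<And>e f. e \<in> E G \<Longrightarrow> f \<in> E G \<Longrightarrow> (q e, q f) \<in> le H \<longleftrightarrow> (e, f) \<in> le G"
    and or: "\<And>e s. e \<in> E G \<Longrightarrow> (q e, s) \<in> \<Q> \<longleftrightarrow> (e, s) \<in> \<O>"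
    and ends: "\<And>e s. e \<in> E G \<Longrightarrow> dart_tail H (q e, s) = p (dart_tail G (e, s))"
      "\<And>e s. e \<in> E G \<Longrightarrow> dart_head H (q e, s) = p (dart_head G (e, s))"
    using isomorphicE[OF iso] by blast
  have U: "U \<subseteq> V G" using bad by (simp add: bad_cut_at_def)
  have mem: "p x \<in> p ` U \<longleftrightarrow> x \<in> U" if "x \<in> V G" for x
    using inj_on_image_mem_iff[OF inj that U] .
  have tl: "dart_tail H (q f, t) \<in> p ` U \<longleftrightarrow> dart_tail G (f, t) \<in> U"
    and hd: "dart_head H (q f, t) \<in> p ` U \<longleftrightarrow> dart_head G (f, t) \<in> U" if "f \<in> E G" for f t
    using mem dart_in_verts[OF wfG, of "(f, t)"] that by (simp_all add: ends)
  have cut: "(q f, t) \<in> cut_darts H (p ` U) \<longleftrightarrow> (f, t) \<in> cut_darts G U" if "f \<in> E G" for f t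
    using that EH by (auto simp: cut_darts_iff[OF wfG] cut_darts_iff[OF wfH] tl hd)
  have eE: "e \<in> E G" using bad by (auto simp: bad_cut_at_def cut_darts_def)
  have signs: "edge_signs \<Q> (q e) = edge_signs \<O> e" using or[OF eE] by (simp add: edge_signs_def)
  have "bad_cut_at X \<delta> H \<Q> (p ` U) (q e) s"
    unfolding bad_cut_at_def
  proof (intro conjI ballI)
    show "p ` U \<subseteq> V H" using U VH by blast
    show "(q e, s) \<in> cut_darts H (p ` U)" using bad cut[OF eE] by (simp add: bad_cut_at_def)
    fix d assume "d \<in> \<Q>"
    then obtain f t where "d = (q f, t)" "f \<in> E G" "(f, t) \<in> \<O>"
      using \<Q> or EH by (cases d) (auto simp: fourientation_def darts_def)
    then show "dart_head H d \<in> p ` U \<longrightarrow> dart_tail H d \<in> p ` U"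
      using bad tl hd by (auto simp: bad_cut_at_def)
  next
    fix g assume g: "g \<in> cut_edges H (p ` U)"
    then obtain f where f: "g = q f" "f \<in> E G" using EH by (auto simp: cut_edges_def)
    then have "f \<in> cut_edges G U" using g cut by (auto simp: cut_edges_iff_dart)
    then show "(q e, g) \<in> le H" using bad le eE f by (auto simp: bad_cut_at_def)
  next
    show "edge_signs \<Q> (q e) \<in> X" using bad signs by (simp add: bad_cut_at_def)
    show "unoriented \<Q> (q e) \<longrightarrow> s = \<delta>"
      using bad signs by (simp add: bad_cut_at_def flip: edge_signs_empty_iff)
  qed
  then show ?thesis by blast
qed

text \<open>A cut and its preimage have the same cut darts, hence the same minimum edge, and darts
  over \<open>A\<close> never enter the preimage. The condition on \<open>W\<close> is there because
  \<open>cut_preimage\<close> ignores elements of \<open>W\<close> that are not vertices of the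
  contraction.\<close>

lemma bad_cut_at_contract_iff:
  assumes G: "ordered_oriented_graph G" and \<O>: "fourientation G \<O>" and A: "A \<subseteq> E G"
  shows "W \<subseteq> V (contract G A) \<and> bad_cut_at X \<delta> G \<O> (cut_preimage G A W) e s \<longleftrightarrow>
    bad_cut_at X \<delta> (contract G A) (restrict_fourientation \<O> (E G - A)) W e s"
proof -
  note wf = oog_wf[OF G]
  let ?R = "restrict_fourientation \<O> (E G - A)" and ?U = "cut_preimage G A W"
  note darts_eq = cut_darts_preimage[OF wf A, of W] and edges_eq = cut_edges_preimage[OF wf A, of W]
  have enter: "(\<forall>d\<in>\<O>. dart_head G d \<in> ?U \<longrightarrow> dart_tail G d \<in> ?U) \<longleftrightarrow>
      (\<forall>d\<in>?R. merge G A (dart_head G d) \<in> W \<longrightarrow> merge G A (dart_tail G d) \<in> W)"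
  proof -
    have "dart_tail G d \<in> V G" "dart_head G d \<in> V G" if "d \<in> \<O>" for d
      using dart_in_verts[OF wf, of d] that \<O> by (auto simp: fourientation_def)
    moreover have "d \<in> ?R \<longleftrightarrow> d \<in> \<O> \<and> fst d \<notin> A" for d
      using \<O> by (cases d) (auto simp: restrict_fourientation_def fourientation_def)
    ultimately show ?thesis
      using merge_dart_eq[OF wf A] by (fastforce simp: cut_preimage_def)
  qed
  have sub: "e \<in> E G - A \<and> f \<in> E G - A" if "(e, s) \<in> cut_darts (contract G A) W"
    "f \<in> cut_edges (contract G A) W" for f
    using that by (auto simp: cut_darts_def cut_edges_def)
  have signs: "edge_signs ?R e = edge_signs \<O> e" if "(e, s) \<in> cut_darts (contract G A) W"
    using that edge_signs_restrict[of e "E G - A"] by (auto simp: cut_darts_def)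
  show ?thesis
    unfolding bad_cut_at_def enter darts_eq edges_eq
    using sub signs cut_preimage_subset[of G A W]
    by (auto simp flip: edge_signs_empty_iff)
qed

text \<open>Here \<open>T\<close> is a union of components of the side opposite to \<open>U\<close>,
  so every edge leaving \<open>T\<close> ends in \<open>U\<close>. Moving \<open>T\<close> over to
  \<open>U\<close> therefore removes exactly these edges from the cut.\<close>

lemma cut_edges_Un_isolated:
  assumes wf: "wf_digraph (gr G)" and U: "U \<subseteq> V G" and T: "T \<subseteq> V G - U"
    and isol: "\<And>f. f \<in> E G \<Longrightarrow> tail (gr G) f \<in> V G - U \<Longrightarrow> head (gr G) f \<in> V G - U \<Longrightarrow>
      tail (gr G) f \<in> T \<longleftrightarrow> head (gr G) f \<in> T"
  shows "cut_edges G (U \<union> T) = cut_edges G U - cut_edges G T" "cut_edges G T \<subseteq> cut_edges G U"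
  using U T isol wf_digraph.wellformed[OF wf] by (auto simp: cut_edges_def)

text \<open>A bad cut with fewest edges is simple: if one of its sides were disconnected, moving a part
  that misses \<open>e\<close> to the other side would leave a bad cut with fewer edges.\<close>

lemma bad_cut_at_simple:
  assumes G: "ordered_oriented_graph G" and bad: "bad_cut_at X \<delta> G \<O> U e s"
    and \<O>: "fourientation G \<O>"
  shows "\<exists>W. simple_cut G W \<and> bad_cut_at X \<delta> G \<O> W e s"
proof -
  note wf = oog_wf[OF G]
  have "\<exists>W. bad_cut_at X \<delta> G \<O> W e s \<and>
      (\<forall>Y. bad_cut_at X \<delta> G \<O> Y e s \<longrightarrow> card (cut_edges G W) \<le> card (cut_edges G Y))"
    using ex_has_least_nat[of "\<lambda>W. bad_cut_at X \<delta> G \<O> W e s" U "\<lambda>W. card (cut_edges G W)"] bad by blast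
  then obtain W where W: "bad_cut_at X \<delta> G \<O> W e s"
    and least: "\<And>Y. bad_cut_at X \<delta> G \<O> Y e s \<Longrightarrow> card (cut_edges G W) \<le> card (cut_edges G Y)" by blast
  have WV: "W \<subseteq> V G" and es: "(e, s) \<in> cut_darts G W" using W by (auto simp: bad_cut_at_def)
  have eW: "dart_tail G (e, s) \<in> W" "dart_head G (e, s) \<in> V G - W" and eE: "e \<in> E G"
    using es by (auto simp: cut_darts_def)
  have fin: "finite (cut_edges G W)"
    using fin_digraph.finite_arcs[OF oog_fin[OF G]] by (auto simp: cut_edges_def)
  \<comment> \<open>By connectivity of \<open>G\<close> some edge leaves \<open>T\<close>, so the
    cut of \<open>Y\<close> would have strictly fewer edges than the least one.\<close>
  have no_smaller: False
    if "bad_cut_at X \<delta> G \<O> Y e s" "cut_edges G Y = cut_edges G W - cut_edges G T"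
      "cut_edges G T \<subseteq> cut_edges G W" "is_cut G T" for Y T
    using least[OF that(1)] psubset_card_mono[OF fin, of "cut_edges G Y"] that
      oog_cut_edges[OF G that(4)] by fastforce
  have dV: "dart_tail G d \<in> V G" "dart_head G d \<in> V G" if "d \<in> \<O>" for d
    using dart_in_verts[OF wf, of d] that \<O> by (auto simp: fourientation_def)
  have dart_closed: "dart_tail G d \<in> T \<longleftrightarrow> dart_head G d \<in> T"
    if "d \<in> darts G" "dart_tail G d \<in> S" "dart_head G d \<in> S"
      "\<forall>f\<in>arcs (gr G \<restriction> S). tail (gr G \<restriction> S) f \<in> T \<longleftrightarrow> head (gr G \<restriction> S) f \<in> T" for d S T
    using that by (cases d; cases "snd d") (auto simp: induce_subgraph_def)
  have wf_induced: "wf_digraph (gr G \<restriction> S)" for S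
    by unfold_locales (auto simp: induce_subgraph_def)
  have "Digraph_Component.connected (gr G \<restriction> (V G - W))"
    unfolding connected_iff_cut[OF wf_induced] induce_subgraph_verts
  proof (intro conjI allI impI)
    show "V G - W \<noteq> {}" using eW by blast
    \<comment> \<open>Moving \<open>T\<close> into \<open>W\<close> keeps \<open>e\<close> in the
      cut because the head of its dart stays outside. No dart of \<open>\<O>\<close> enters
      \<open>W \<union> T\<close>: one with head in \<open>T\<close> starts in \<open>T\<close> or
      in \<open>W\<close>.\<close>
    have False if T: "T \<subseteq> V G - W" "T \<noteq> {}" "dart_head G (e, s) \<notin> T"
      "\<forall>f\<in>arcs (gr G \<restriction> (V G - W)). tail (gr G \<restriction> (V G - W)) f \<in> T \<longleftrightarrow> head (gr G \<restriction> (V G - W)) f \<in> T" for T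
    proof (rule no_smaller)
      have iso: "f \<in> E G \<Longrightarrow> tail (gr G) f \<in> V G - W \<Longrightarrow> head (gr G) f \<in> V G - W \<Longrightarrow>
          tail (gr G) f \<in> T \<longleftrightarrow> head (gr G) f \<in> T" for f
        using T(4) by (auto simp: induce_subgraph_def)
      note Un = cut_edges_Un_isolated[OF wf WV T(1) iso]
      show "cut_edges G (W \<union> T) = cut_edges G W - cut_edges G T" "cut_edges G T \<subseteq> cut_edges G W"
        using Un by auto
      show "is_cut G T" using T WV eW by (auto simp: is_cut_def)
      have "(e, s) \<in> cut_darts G (W \<union> T)"
        using es T(1,3) by (auto simp: cut_darts_def)
      moreover have "dart_tail G d \<in> W \<union> T" if "d \<in> \<O>" "dart_head G d \<in> W \<union> T" for d
        using dart_closed[OF _ _ _ T(4), of d] dV[of d] that W T(1) \<O>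
        by (auto simp: bad_cut_at_def fourientation_def)
      ultimately show "bad_cut_at X \<delta> G \<O> (W \<union> T) e s"
        using W T(1) Un by (auto simp: bad_cut_at_def)
    qed
    note contra = this
    fix T assume T: "T \<subseteq> V G - W \<and> T \<noteq> {} \<and>
      (\<forall>f\<in>arcs (gr G \<restriction> (V G - W)). tail (gr G \<restriction> (V G - W)) f \<in> T \<longleftrightarrow> head (gr G \<restriction> (V G - W)) f \<in> T)"
    show "T = V G - W"
    proof (rule ccontr)
      assume ne: "T \<noteq> V G - W"
      show False
      \<comment> \<open>If the head lies in \<open>T\<close>, the rest of the side is moved instead;
        it is a union of components as well.\<close>
      proof (cases "dart_head G (e, s) \<in> T")
        case True
        show False
          by (rule contra[of "V G - W - T"]) (use T True ne in \<open>auto simp: induce_subgraph_def\<close>)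
      qed (use contra T in blast)
    qed
  qed
  moreover have "Digraph_Component.connected (gr G \<restriction> W)"
    unfolding connected_iff_cut[OF wf_induced] induce_subgraph_verts
  proof (intro conjI allI impI)
    show "W \<noteq> {}" using eW by blast
    \<comment> \<open>The mirror case: removing \<open>T\<close> from \<open>W\<close> keeps the
      tail. A dart of \<open>\<O>\<close> with head in \<open>W - T\<close> starts in
      \<open>W\<close>, and not in \<open>T\<close>, since no edge joins \<open>T\<close> to
      \<open>W - T\<close>.\<close>
    have False if T: "T \<subseteq> W" "T \<noteq> {}" "dart_tail G (e, s) \<notin> T"
      "\<forall>f\<in>arcs (gr G \<restriction> W). tail (gr G \<restriction> W) f \<in> T \<longleftrightarrow> head (gr G \<restriction> W) f \<in> T" for T
    proof (rule no_smaller)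
      have iso: "f \<in> E G \<Longrightarrow> tail (gr G) f \<in> W \<Longrightarrow> head (gr G) f \<in> W \<Longrightarrow>
          tail (gr G) f \<in> T \<longleftrightarrow> head (gr G) f \<in> T" for f
        using T(4) by (auto simp: induce_subgraph_def)
      have eq: "cut_edges G (W - T) = cut_edges G W - cut_edges G T"
        and sub: "cut_edges G T \<subseteq> cut_edges G W"
        using iso T(1) WV wf_digraph.wellformed[OF wf] by (auto simp: cut_edges_def)
      then show "cut_edges G (W - T) = cut_edges G W - cut_edges G T" "cut_edges G T \<subseteq> cut_edges G W"
        by auto
      show "is_cut G T" using T WV eW by (auto simp: is_cut_def)
      have "(e, s) \<in> cut_darts G (W - T)"
        using es T(1,3) by (auto simp: cut_darts_def)
      moreover have "dart_tail G d \<in> W - T" if "d \<in> \<O>" "dart_head G d \<in> W - T" for d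
        using dart_closed[OF _ _ _ T(4), of d] dV[of d] that W T(1) \<O>
        by (auto simp: bad_cut_at_def fourientation_def)
      ultimately show "bad_cut_at X \<delta> G \<O> (W - T) e s"
        using W eq by (auto simp: bad_cut_at_def)
    qed
    note contra = this
    fix T assume T: "T \<subseteq> W \<and> T \<noteq> {} \<and>
      (\<forall>f\<in>arcs (gr G \<restriction> W). tail (gr G \<restriction> W) f \<in> T \<longleftrightarrow> head (gr G \<restriction> W) f \<in> T)"
    show "T = W"
    proof (rule ccontr)
      assume ne: "T \<noteq> W"
      show False
      proof (cases "dart_tail G (e, s) \<in> T")
        case True
        show False
          by (rule contra[of "W - T"]) (use T True ne in \<open>auto simp: induce_subgraph_def\<close>)
      qed (use contra T in blast)
    qed
  qed
  ultimately have "simple_cut G W" using is_cutI[OF WV es] by (simp add: simple_cut_def)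
  then show ?thesis using W by blast
qed

text \<open>A bad cut of a minor pulls back to a bad cut of \<open>G\<close>. Conversely, a bad cut
  of \<open>G\<close> can be taken simple, and then it survives as a bad cut of its own
  minor.\<close>

lemma cut_property_if_bad_cut_at:
  fixes P :: "('v, 'e) property"
  assumes P: "\<And>G \<O>. ordered_oriented_graph G \<Longrightarrow> fourientation G \<O> \<Longrightarrow>
    P G \<O> \<longleftrightarrow> \<not> (\<exists>U e s. bad_cut_at X \<delta> G \<O> U e s)"
  shows "cut_property P"
  unfolding cut_property_def
proof (intro conjI allI impI)
  have transport: "P H \<Q>" if G: "ordered_oriented_graph G" "fourientation G \<O>"
    and H: "ordered_oriented_graph H" "fourientation H \<Q>"
    and iso: "isomorphic G \<O> H \<Q>" and good: "P G \<O>" for G H :: "('v, 'e) ograph" and \<O> \<Q>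
    using bad_cut_at_isomorphic[OF H(1) G(1) G(2) isomorphic_sym[OF G(1) H(1) iso]] P[OF G] P[OF H] good
    by blast
  show "fourientation_property P"
    unfolding fourientation_property_def
  proof (intro allI impI, elim conjE)
    fix G H :: "('v, 'e) ograph" and \<O> \<Q>
    assume A: "ordered_oriented_graph G" "fourientation G \<O>" "ordered_oriented_graph H"
      "fourientation H \<Q>" and iso: "isomorphic G \<O> H \<Q>"
    show "P G \<O> \<longleftrightarrow> P H \<Q>"
      using transport[OF A iso] transport[OF A(3,4,1,2) isomorphic_sym[OF A(1,3) iso]] by (rule iffI)
  qed
  fix G :: "('v, 'e) ograph" and \<O>
  assume "ordered_oriented_graph G \<and> fourientation G \<O>"
  then have G: "ordered_oriented_graph G" and \<O>: "fourientation G \<O>" by auto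
  note wf = oog_wf[OF G]
  have minor: "P (cut_minor G U) (restrict_fourientation \<O> (cut_edges G U)) \<longleftrightarrow>
      \<not> (\<exists>W e s. W \<subseteq> V (cut_minor G U) \<and>
        bad_cut_at X \<delta> G \<O> (cut_preimage G (E G - cut_edges G U) W) e s)" for U
  proof -
    have eq: "E G - (E G - cut_edges G U) = cut_edges G U" by (auto simp: cut_edges_def)
    have "ordered_oriented_graph (cut_minor G U)"
      using oog_contract[OF G] by (simp add: cut_minor_def)
    moreover have "fourientation (cut_minor G U) (restrict_fourientation \<O> (cut_edges G U))"
      unfolding fourientation_def cut_minor_def restrict_fourientation_def darts_def contract_simps eq
      by blast
    ultimately show ?thesis
      unfolding bad_cut_at_contract_iff[OF G \<O> Diff_subset[of "E G" "cut_edges G U"],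
        unfolded eq, folded cut_minor_def] by (rule P)
  qed
  show "P G \<O> \<longleftrightarrow> (\<forall>U. simple_cut G U \<longrightarrow>
      P (cut_minor G U) (restrict_fourientation \<O> (cut_edges G U)))"
  proof (intro iffI allI impI)
    show "P (cut_minor G U) (restrict_fourientation \<O> (cut_edges G U))" if "P G \<O>" for U
      using that P[OF G \<O>] minor by blast
  next
    assume minors: "\<forall>U. simple_cut G U \<longrightarrow>
      P (cut_minor G U) (restrict_fourientation \<O> (cut_edges G U))"
    show "P G \<O>"
    proof (rule ccontr)
      assume "\<not> P G \<O>"
      then obtain U e s where bad: "bad_cut_at X \<delta> G \<O> U e s" and simple: "simple_cut G U"
        using P[OF G \<O>] bad_cut_at_simple[OF G _ \<O>] by blast
      have UV: "U \<subseteq> V G" using bad by (simp add: bad_cut_at_def)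
      let ?A = "E G - cut_edges G U"
      \<comment> \<open>No contracted edge crosses \<open>U\<close>, so \<open>U\<close> is
        recovered from its image in the minor.\<close>
      have "cut_preimage G ?A (merge G ?A ` U) = U"
        using cut_preimage_image[OF wf _ UV, of ?A] by blast
      moreover have "merge G ?A ` U \<subseteq> V (cut_minor G U)" using UV by (auto simp: cut_minor_def)
      ultimately have "\<exists>W \<subseteq> V (cut_minor G U). bad_cut_at X \<delta> G \<O> (cut_preimage G ?A W) e s"
        using bad by (intro exI[of _ "merge G ?A ` U"]) simp
      then show False using minors simple minor by blast
    qed
  qed
qed

section \<open>Deleting the maximum edge, and uncrossing bad cuts\<close>

lemma bad_cut_at_delete_max:
  assumes G: "ordered_oriented_graph G" and e: "is_max_edge G e" "\<not> isthmus G e"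
    and \<O>: "fourientation (delete G {e}) \<O>" and D: "D \<subseteq> {e} \<times> UNIV"
  shows "bad_cut_at X \<delta> G (\<O> \<union> D) U f t \<longleftrightarrow> bad_cut_at X \<delta> (delete G {e}) \<O> U f t \<and>
    (\<forall>d\<in>D. dart_head G d \<in> U \<longrightarrow> dart_tail G d \<in> U)"
proof -
  have darts: "cut_darts (delete G {e}) U = {d \<in> cut_darts G U. fst d \<noteq> e}"
    by (auto simp: cut_darts_def darts_def)
  have signs: "edge_signs (\<O> \<union> D) f = edge_signs \<O> f" if "f \<noteq> e"
    using D that by (auto simp: edge_signs_def)
  \<comment> \<open>Since \<open>e\<close> is no isthmus, each cut has an edge other than
    \<open>e\<close>, so the maximum edge \<open>e\<close> is never the minimum of a cut. Thus
    \<open>D\<close> matters only for which sets are entered.\<close>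
  have neq: "f \<noteq> e" if "bad_cut_at X \<delta> G (\<O> \<union> D) U f t"
  proof -
    have cut: "(f, t) \<in> cut_darts G U" "U \<subseteq> V G" and min: "is_min_edge G (cut_edges G U) f"
      using that by (auto simp: bad_cut_at_def is_min_edge_def cut_edges_iff_dart)
    have "cut_edges G U \<noteq> {e}" using e(2) is_cutI[OF cut(2,1)] by (auto simp: isthmus_def)
    then obtain g where "g \<in> cut_edges G U" "g \<noteq> e"
      using cut(1) cut_edges_iff_dart[of f G U] by blast
    then show ?thesis using is_max_edge_not_min[OF G e(1) min] by (auto simp: cut_edges_def)
  qed
  have "f \<in> E G \<and> f \<noteq> e" if "bad_cut_at X \<delta> (delete G {e}) \<O> U f t"
    using that by (auto simp: bad_cut_at_def cut_darts_def)
  moreover have "bad_cut_at X \<delta> G (\<O> \<union> D) U f t \<longleftrightarrow> bad_cut_at X \<delta> (delete G {e}) \<O> U f t \<and>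
    (\<forall>d\<in>D. dart_head G d \<in> U \<longrightarrow> dart_tail G d \<in> U)" if f: "f \<in> E G" "f \<noteq> e"
  proof -
    \<comment> \<open>Putting \<open>e\<close> back into the cut leaves \<open>f\<close> minimal
      because \<open>e\<close> is the maximum.\<close>
    have "(\<forall>g\<in>cut_edges G U. (f, g) \<in> le G) \<longleftrightarrow>
        (\<forall>g\<in>cut_edges (delete G {e}) U. (f, g) \<in> le (delete G {e}))"
      using f e(1) by (auto simp: cut_edges_delete is_max_edge_def) (auto simp: cut_edges_def)
    then show ?thesis
      unfolding bad_cut_at_def darts signs[OF f(2)] edge_signs_empty_iff[symmetric]
      using f by auto
  qed
  moreover have "f \<in> E G" if "bad_cut_at X \<delta> G (\<O> \<union> D) U f t"
    using that by (auto simp: bad_cut_at_def cut_darts_def)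
  ultimately show ?thesis using neq by blast
qed

text \<open>As \<open>f\<close> is the smaller minimum, it is a lower bound for all edges crossing
  either cut, hence for those crossing the intersection or the union. It remains to see that
  \<open>f\<close> crosses one of these in direction \<open>t\<close>.\<close>

lemma bad_cut_at_uncross:
  assumes G: "ordered_oriented_graph G"
    and U: "bad_cut_at X \<delta> G \<O> U f t" and W: "bad_cut_at X \<delta> G \<O> W g t'"
    and le: "(f, g) \<in> le G"
  shows "bad_cut_at X \<delta> G \<O> (U \<inter> W) f t \<or> bad_cut_at X \<delta> G \<O> (U \<union> W) f t"
proof -
  note wf = oog_wf[OF G]
  have UV: "U \<subseteq> V G" and WV: "W \<subseteq> V G" using U W by (auto simp: bad_cut_at_def)
  have ft: "f \<in> E G" "dart_tail G (f, t) \<in> U" "dart_head G (f, t) \<notin> U"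
    and gt: "g \<in> E G" "dart_tail G (g, t') \<in> W" "dart_head G (g, t') \<notin> W"
    using U W by (auto simp: bad_cut_at_def cut_darts_iff[OF wf])
  have nent: "(f, opp t) \<notin> \<O>" "(g, opp t') \<notin> \<O>"
    using U W ft gt by (force simp: bad_cut_at_def)+
  \<comment> \<open>The dart \<open>(f, t)\<close> cannot enter \<open>W\<close>. Otherwise
    minimality of \<open>g\<close> forces \<open>f = g\<close> with opposite directions; neither
    orientation is then in \<open>\<O>\<close>, and an unoriented minimum has direction \<delta> in
    both bad cuts.\<close>
  have cross: "(dart_tail G (f, t) \<in> W \<or> dart_head G (f, t) \<notin> W)"
  proof (rule ccontr)
    assume neg: "\<not> (dart_tail G (f, t) \<in> W \<or> dart_head G (f, t) \<notin> W)"
    then have "f \<in> cut_edges G W" using cut_edges_iff[OF wf WV, of f t] ft by blast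
    then have "(g, f) \<in> le G" using W by (simp add: bad_cut_at_def)
    then have fg: "f = g" using oog_le_antisym[OF G] le by blast
    then have "t' = opp t" using neg gt sign_cases[of t' t] by auto
    moreover have "unoriented \<O> f"
      using nent fg \<open>t' = opp t\<close> by (cases t) (auto simp: unoriented_def)
    ultimately show False using U W fg by (auto simp: bad_cut_at_def)
  qed
  have edges: "cut_edges G (U \<inter> W) \<union> cut_edges G (U \<union> W) \<subseteq> cut_edges G U \<union> cut_edges G W"
    by (auto simp: cut_edges_def)
  have min: "(f, h) \<in> le G" if "h \<in> cut_edges G U \<union> cut_edges G W" for h
    using U W that oog_le_trans[OF G le] by (auto simp: bad_cut_at_def)
  have side: "bad_cut_at X \<delta> G \<O> Z f t"
    if "Z = U \<inter> W \<or> Z = U \<union> W" "dart_tail G (f, t) \<in> Z" "dart_head G (f, t) \<notin> Z" for Z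
    unfolding bad_cut_at_def
  proof (intro conjI ballI impI)
    show "Z \<subseteq> V G" using that UV WV by auto
    show "(f, t) \<in> cut_darts G Z" using that ft by (simp add: cut_darts_iff[OF wf])
    show "dart_tail G d \<in> Z" if "d \<in> \<O>" "dart_head G d \<in> Z" for d
      using that \<open>Z = U \<inter> W \<or> Z = U \<union> W\<close> U W by (auto simp: bad_cut_at_def)
    show "(f, h) \<in> le G" if "h \<in> cut_edges G Z" for h
      using min that edges \<open>Z = U \<inter> W \<or> Z = U \<union> W\<close> by blast
    show "edge_signs \<O> f \<in> X" using U by (simp add: bad_cut_at_def)
    show "t = \<delta>" if "unoriented \<O> f" using U that by (simp add: bad_cut_at_def)
  qed
  show ?thesis
  proof (cases "dart_tail G (f, t) \<in> W")
    case True
    then show ?thesis using side[of "U \<inter> W"] ft by blast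
  next
    case False
    then show ?thesis using side[of "U \<union> W"] ft cross by blast
  qed
qed

lemma tutte_cut_property_if_min_edge_cut_property:
  fixes P :: "('v, 'e) property"
  assumes "min_edge_cut_property P"
  shows "tutte_cut_property P"
proof -
  obtain X \<delta> where all_good: "\<forall>G \<O>. ordered_oriented_graph G \<and> fourientation G \<O> \<longrightarrow>
      (P G \<O> \<longleftrightarrow> (\<forall>U. potential_cut G \<O> U \<longrightarrow> \<not> bad_cut X \<delta> G \<O> U))"
    using assms unfolding min_edge_cut_property_def by (elim exE conjE)
  note good = all_good[rule_format, OF conjI]
  have P: "P G \<O> \<longleftrightarrow> \<not> (\<exists>U e s. bad_cut_at X \<delta> G \<O> U e s)"
    if "ordered_oriented_graph G" "fourientation G \<O>" for G \<O>
    using good[OF that] ex_bad_cut_iff[OF that] by blast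
  have T2: "(P (delete G {e}) \<O> \<longrightarrow> P G (\<O> \<union> {(e, Plus)}) \<and> P G (\<O> \<union> {(e, Minus)})) \<and>
    (\<not> P (delete G {e}) \<O> \<and> P G (\<O> \<union> {(e, Plus), (e, Minus)}) \<longrightarrow>
      (P G (\<O> \<union> {(e, Plus)}) \<longleftrightarrow> \<not> P G (\<O> \<union> {(e, Minus)}))) \<and>
    (P (delete G {e}) \<O> \<longleftrightarrow> P G \<O>)"
    if G: "ordered_oriented_graph G" and e: "is_max_edge G e" "\<not> isthmus G e" and \<O>: "fourientation (delete G {e}) \<O>"
    for G :: "('v, 'e) ograph" and e \<O>
  proof -
    note H = oog_delete[OF G e(2)]
    let ?bad = "bad_cut_at X \<delta> (delete G {e}) \<O>"
    let ?admits = "\<lambda>D U. \<forall>d\<in>D. dart_head G d \<in> U \<longrightarrow> dart_tail G d \<in> U"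
    have PH: "P (delete G {e}) \<O> \<longleftrightarrow> \<not> (\<exists>U f t. ?bad U f t)" using P[OF H \<O>] .
    \<comment> \<open>All four fourientations extending \<open>\<O>\<close> by orientations of
      \<open>e\<close> are compared on one family, the bad cuts of the deletion; they differ only in
      which of these cuts \<open>D\<close> may not enter.\<close>
    have PG: "P G (\<O> \<union> D) \<longleftrightarrow> \<not> (\<exists>U f t. ?bad U f t \<and> ?admits D U)" if D: "D \<subseteq> {e} \<times> UNIV" for D
    proof -
      have "fourientation G (\<O> \<union> D)"
        using \<O> D e(1) by (auto simp: fourientation_def darts_def is_max_edge_def)
      show ?thesis
        unfolding P[OF G \<open>fourientation G (\<O> \<union> D)\<close>] bad_cut_at_delete_max[OF G e \<O> D] by (rule refl)
    qed
    have both_bad: "\<exists>U f t. ?bad U f t \<and> ?admits {(e, Plus), (e, Minus)} U"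
      if U: "?bad U f t" "?admits {(e, Plus)} U" and W: "?bad W g t'" "?admits {(e, Minus)} W" for U f t W g t'
    proof (cases "?admits {(e, Minus)} U \<or> ?admits {(e, Plus)} W")
      case True
      then show ?thesis using U W by blast
    next
      case False
      \<comment> \<open>Now \<open>e\<close> runs from \<open>U\<close> to \<open>W\<close> with its
        tail outside \<open>W\<close> and its head outside \<open>U\<close>: both ends lie in the
        union and neither in the intersection.\<close>
      then have "?admits {(e, Plus), (e, Minus)} (U \<inter> W)" "?admits {(e, Plus), (e, Minus)} (U \<union> W)"
        by auto
      moreover have "f \<in> E (delete G {e})" "g \<in> E (delete G {e})"
        using U(1) W(1) by (auto simp: bad_cut_at_def cut_darts_def)
      then have "(f, g) \<in> le (delete G {e}) \<or> (g, f) \<in> le (delete G {e})"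
        using oog_le_total[OF H] by blast
      then have "(\<exists>f t. ?bad (U \<inter> W) f t) \<or> (\<exists>f t. ?bad (U \<union> W) f t)"
        using bad_cut_at_uncross[OF H U(1) W(1)] bad_cut_at_uncross[OF H W(1) U(1)]
        unfolding Int_commute[of W U] Un_commute[of W U] by blast
      ultimately show ?thesis by blast
    qed
    \<comment> \<open>An edge enters a given set in at most one direction. So a bad cut of the
      deletion remains bad for one of the two orientations, while \<open>both_bad\<close> excludes
      that both are bad.\<close>
    have one_bad: "?admits {(e, Plus)} U \<or> ?admits {(e, Minus)} U" for U by auto
    have "P G \<O> \<longleftrightarrow> P (delete G {e}) \<O>" using PG[of "{}"] PH by simp
    moreover have "P (delete G {e}) \<O> \<Longrightarrow> P G (\<O> \<union> {(e, s)})" for s using PG[of "{(e, s)}"] PH by auto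
    moreover have "P G (\<O> \<union> {(e, Plus)}) \<longleftrightarrow> \<not> P G (\<O> \<union> {(e, Minus)})"
      if "\<not> P (delete G {e}) \<O>" "P G (\<O> \<union> {(e, Plus), (e, Minus)})"
    proof
      assume "P G (\<O> \<union> {(e, Plus)})"
      then show "\<not> P G (\<O> \<union> {(e, Minus)})"
        using that(1) PH PG[of "{(e, Plus)}"] PG[of "{(e, Minus)}"] one_bad by blast
    next
      assume "\<not> P G (\<O> \<union> {(e, Minus)})"
      then show "P G (\<O> \<union> {(e, Plus)})"
        using that(2) PG[of "{(e, Plus)}"] PG[of "{(e, Minus)}"] PG[of "{(e, Plus), (e, Minus)}"] both_bad
        by blast
    qed
    ultimately show ?thesis by blast
  qed
  have "\<exists>U. potential_cut G \<O> U" if "ordered_oriented_graph G" "fourientation G \<O>" "\<not> P G \<O>" for G \<O>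
    using good[OF that(1,2)] that(3) by blast
  then show ?thesis
    unfolding tutte_cut_property_def using cut_property_if_bad_cut_at[OF P] T2 by simp
qed

section \<open>Min-edge cycle properties\<close>

lemma steps_rtrancl_mono:
  assumes "(x, y) \<in> (steps G D)\<^sup>*" "D \<subseteq> D'"
  shows "(x, y) \<in> (steps G D')\<^sup>*"
  using rtrancl_mono[OF steps_mono[OF assms(2)]] assms(1) by blast

text \<open>\<open>e\<^sup>s\<close> lies on a bad potential cycle with minimum edge \<open>e\<close> iff the head of \<open>e\<^sup>s\<close> is joined
  to its tail by a directed walk in \<open>\<O>\<close> along edges larger than \<open>e\<close>; so cycles themselves
  can be replaced by reachability.\<close>

definition later :: "('v, 'e) ograph \<Rightarrow> 'e dart set \<Rightarrow> 'e \<Rightarrow> 'e dart set" where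
  "later G \<O> e = {d \<in> \<O>. (e, fst d) \<in> le G \<and> fst d \<noteq> e}"

definition bad_cycle_at ::
  "sign set set \<Rightarrow> sign \<Rightarrow> ('v, 'e) ograph \<Rightarrow> 'e dart set \<Rightarrow> 'e \<Rightarrow> sign \<Rightarrow> bool" where
  "bad_cycle_at X \<delta> G \<O> e s \<longleftrightarrow> (e, s) \<in> \<O> \<and> edge_signs \<O> e \<in> X \<and> (bioriented \<O> e \<longrightarrow> s = \<delta>) \<and>
     (dart_head G (e, s), dart_tail G (e, s)) \<in> (steps G (later G \<O> e))\<^sup>*"

text \<open>Removing a dart from a cycle leaves a walk from its head back to its tail, and
  distinctness of the edges keeps the edge of the dart off this walk.\<close>

lemma dcycle_closing_steps:
  assumes c: "is_dcycle G c" and d: "d \<in> dcycle_darts c"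
  shows "(dart_head G d, dart_tail G d) \<in> (steps G {d' \<in> dcycle_darts c. fst d' \<noteq> fst d})\<^sup>*"
proof -
  let ?n = "length c" and ?R = "(steps G {d' \<in> dcycle_darts c. fst d' \<noteq> fst d})\<^sup>*"
  obtain i where i: "i < ?n" "snd (c ! i) = d"
    using d by (auto simp: dcycle_darts_def in_set_conv_nth)
  have ends: "dart_tail G (snd (c ! j)) = fst (c ! j)"
    "dart_head G (snd (c ! j)) = fst (c ! (Suc j mod ?n))" if "j < ?n" for j
    using c that by (auto simp: is_dcycle_def)
  have "(fst (c ! (Suc i mod ?n)), fst (c ! ((Suc i + k) mod ?n))) \<in> ?R" if "k < ?n" for k
    using that
  proof (induct k)
    case (Suc k)
    let ?j = "(Suc i + k) mod ?n"
    have j: "?j < ?n" using i by (intro mod_less_divisor) auto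
    \<comment> \<open>The walk starts at position \<open>i + 1\<close> and takes fewer than
      \<open>?n\<close> steps, so it never traverses position \<open>i\<close>.\<close>
    have "?j \<noteq> i"
    proof (cases "Suc i + k < ?n")
      case False
      then have "?j = Suc i + k - ?n" using Suc.prems i by (simp add: le_mod_geq)
      then show ?thesis using Suc.prems False by linarith
    qed simp
    then have "fst (snd (c ! ?j)) \<noteq> fst d"
      using c i j nth_eq_iff_index_eq[of "map (fst \<circ> snd) c" ?j i] by (auto simp: is_dcycle_def)
    then have "(dart_tail G (snd (c ! ?j)), dart_head G (snd (c ! ?j))) \<in>
        steps G {d' \<in> dcycle_darts c. fst d' \<noteq> fst d}"
      using j by (auto simp: steps_def dcycle_darts_def)
    then have "(fst (c ! ?j), fst (c ! (Suc ?j mod ?n))) \<in> steps G {d' \<in> dcycle_darts c. fst d' \<noteq> fst d}"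
      using ends[OF j] by simp
    moreover have "Suc ?j mod ?n = (Suc i + Suc k) mod ?n" by (simp add: mod_Suc_eq)
    ultimately show ?case using Suc by (simp add: rtrancl_into_rtrancl)
  qed simp
  \<comment> \<open>After \<open>?n - 1\<close> steps the walk is back at position \<open>i\<close>,
    the tail of \<open>d\<close>.\<close>
  from this[of "?n - 1"] have "(fst (c ! (Suc i mod ?n)), fst (c ! ((Suc i + (?n - 1)) mod ?n))) \<in> ?R"
    using i(1) by simp
  moreover have "Suc i + (?n - 1) = i + ?n" using i(1) by simp
  ultimately show ?thesis using i(1) ends[OF i(1)] by (simp add: i(2))
qed

text \<open>The list format is that of directed cycles: each dart is paired with its tail, and the
  final vertex is not listed. A closed path can thus be read as a cycle without conversion.\<close>

fun dpath :: "('v, 'e) ograph \<Rightarrow> 'v \<Rightarrow> ('v \<times> 'e dart) list \<Rightarrow> 'v \<Rightarrow> bool" where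
  "dpath G x [] y \<longleftrightarrow> x = y"
| "dpath G x ((v, d) # p) y \<longleftrightarrow> v = x \<and> dart_tail G d = x \<and> dpath G (dart_head G d) p y"

lemma dpath_append: "dpath G x (p @ q) y \<longleftrightarrow> (\<exists>z. dpath G x p z \<and> dpath G z q y)"
  by (induct p arbitrary: x) auto

lemma dpath_start: "dpath G x p y \<Longrightarrow> p \<noteq> [] \<Longrightarrow> fst (p ! 0) = x"
  by (cases p) auto

lemma dpath_nth:
  assumes "dpath G x p y" "i < length p"
  shows "dart_tail G (snd (p ! i)) = fst (p ! i)"
    "dart_head G (snd (p ! i)) = (if Suc i < length p then fst (p ! Suc i) else y)"
  using assms
proof (induct p arbitrary: x i)
  case (Cons a p)
  obtain v d where a: "a = (v, d)" by (cases a)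
  case 1
  then show ?case using Cons(1) by (cases i) (auto simp: a)
  case 2
  then show ?case using Cons(2) dpath_start[of G "dart_head G d" p y]
    by (cases i) (auto simp: a)
qed simp_all

lemma dpath_heads:
  assumes "dpath G x p y" "(v, d) \<in> set p"
  shows "dart_tail G d = v" "dart_head G d \<in> insert y (fst ` set p)"
proof -
  obtain i where i: "i < length p" "p ! i = (v, d)" using assms(2) by (auto simp: in_set_conv_nth)
  show "dart_tail G d = v" "dart_head G d \<in> insert y (fst ` set p)"
    using dpath_nth[OF assms(1) i(1)] i by (auto split: if_splits)
qed

text \<open>A second dart over the first edge, in either direction, would have the first vertex as
  an end. But ends of later darts are later listed vertices or \<open>y\<close>, all different from
  the first vertex.\<close>

lemma dpath_distinct_edges:
  assumes "dpath G x p y" "distinct (map fst p)" "y \<notin> fst ` set p"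
  shows "distinct (map (fst \<circ> snd) p)"
  using assms
proof (induct p arbitrary: x)
  case (Cons a p)
  obtain e s where a: "a = (x, (e, s))" and tl: "dart_tail G (e, s) = x"
    and p: "dpath G (dart_head G (e, s)) p y"
    using Cons.prems(1) by (cases a) auto
  have x: "x \<notin> insert y (fst ` set p)" using Cons.prems by (auto simp: a)
  have False if "(v, (e, t)) \<in> set p" for v t
    using dpath_heads[OF p that] x tl that sign_cases[of t s] by force
  then show ?case using Cons.hyps[OF p] Cons.prems by (auto simp: a)
qed simp

lemma steps_imp_dpath:
  assumes "(x, y) \<in> (steps G D)\<^sup>*"
  shows "\<exists>p. dpath G x p y \<and> distinct (map fst p) \<and> y \<notin> fst ` set p \<and> snd ` set p \<subseteq> D"
  using assms
proof (induct rule: converse_rtrancl_induct)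
  case base
  show ?case by (intro exI[of _ "[]"]) simp
next
  case (step x z)
  then obtain p where p: "dpath G z p y" "distinct (map fst p)" "y \<notin> fst ` set p" "snd ` set p \<subseteq> D"
    by blast
  obtain d where d: "d \<in> D" "x = dart_tail G d" "z = dart_head G d"
    using step(1) by (auto simp: steps_def)
  \<comment> \<open>If the new vertex already occurs, the walk is cut short there; only a new vertex
    lengthens the path.\<close>
  consider "x = y" | "x \<in> fst ` set p" | "x \<noteq> y" "x \<notin> fst ` set p" by blast
  then show ?case
  proof cases
    case 1
    then show ?thesis by (intro exI[of _ "[]"]) simp
  next
    case 2
    then obtain a where "a \<in> set p" "fst a = x" by blast
    then obtain q r where q: "p = q @ a # r" "fst a = x" by (meson split_list)
    then have "dpath G x (a # r) y" using p(1) by (cases a) (auto simp: dpath_append)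
    then show ?thesis using p q by (intro exI[of _ "a # r"]) auto
  next
    case 3
    then show ?thesis using p d by (intro exI[of _ "(x, d) # p"]) auto
  qed
qed

lemma steps_imp_simple_dcycle:
  assumes D: "insert (e, s) D \<subseteq> darts G" and e: "\<And>t. (e, t) \<notin> D"
    and reach: "(dart_head G (e, s), dart_tail G (e, s)) \<in> (steps G D)\<^sup>*"
  shows "\<exists>c. is_dcycle G c \<and> distinct (map fst c) \<and> (e, s) \<in> dcycle_darts c \<and>
    dcycle_darts c \<subseteq> insert (e, s) D"
proof -
  let ?x = "dart_tail G (e, s)"
  obtain p where p: "dpath G (dart_head G (e, s)) p ?x" "distinct (map fst p)"
    "?x \<notin> fst ` set p" "snd ` set p \<subseteq> D"
    using steps_imp_dpath[OF reach] by blast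
  let ?c = "(?x, (e, s)) # p"
  have path: "dpath G ?x ?c ?x" using p(1) by simp
  \<comment> \<open>The closing path avoids \<open>e\<close> altogether, so prepending
    \<open>(e, s)\<close> keeps the edges distinct.\<close>
  have "e \<notin> (fst \<circ> snd) ` set p" using p(4) e by fastforce
  then have dist: "distinct (map (fst \<circ> snd) ?c)"
    using dpath_distinct_edges[OF p(1-3)] by simp
  have "is_dcycle G ?c"
    unfolding is_dcycle_def
  proof (intro conjI allI impI)
    fix i assume i: "i < length ?c"
    have "snd (?c ! i) \<in> snd ` set ?c" using nth_mem[OF i] by blast
    then show "snd (?c ! i) \<in> darts G" using D p(4) by auto
    show "dart_tail G (snd (?c ! i)) = fst (?c ! i)" using dpath_nth(1)[OF path i] .
    show "dart_head G (snd (?c ! i)) = fst (?c ! (Suc i mod length ?c))"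
      using dpath_nth(2)[OF path i] i by (cases "Suc i < length ?c") (auto simp: not_less less_Suc_eq)
  qed (use dist in simp_all)
  then show ?thesis using p by (intro exI[of _ ?c]) (auto simp: dcycle_darts_def)
qed

lemma bad_cycle_at_simple:
  assumes \<O>: "fourientation G \<O>" and bad: "bad_cycle_at X \<delta> G \<O> e s"
  shows "\<exists>c. is_dcycle G c \<and> distinct (map fst c) \<and> (e, s) \<in> dcycle_darts c \<and>
    dcycle_darts c \<subseteq> insert (e, s) (later G \<O> e)"
  using assms by (intro steps_imp_simple_dcycle) (auto simp: bad_cycle_at_def later_def fourientation_def)

lemma ex_bad_cycle_iff:
  assumes G: "ordered_oriented_graph G" and \<O>: "fourientation G \<O>"
  shows "(\<exists>c. potential_cycle G \<O> c \<and> bad_cycle X \<delta> G \<O> c) \<longleftrightarrow> (\<exists>e s. bad_cycle_at X \<delta> G \<O> e s)"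
proof
  assume "\<exists>c. potential_cycle G \<O> c \<and> bad_cycle X \<delta> G \<O> c"
  then obtain c where c: "is_dcycle G c" "dcycle_darts c \<subseteq> \<O>" and bad: "bad_cycle X \<delta> G \<O> c"
    by (auto simp: potential_cycle_def)
  have "dcycle_darts c \<noteq> {}" using c(1) by (auto simp: is_dcycle_def dcycle_darts_def)
  moreover have "dcycle_edges c \<subseteq> E G"
    using c(2) \<O> by (auto simp: dcycle_edges_def fourientation_def darts_def)
  ultimately obtain e where e: "is_min_edge G (dcycle_edges c) e"
    using ex_is_min_edge[OF G, of "dcycle_edges c"] by (auto simp: dcycle_edges_def)
  have signs: "edge_signs \<O> e \<in> X" "bioriented \<O> e \<Longrightarrow> (e, \<delta>) \<in> dcycle_darts c"
    using bad min_edge_eq[OF G e] by (auto simp: bad_cycle_def Let_def)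
  \<comment> \<open>Dually to cuts, the sign is prescribed by \<delta> exactly when the minimum is
    bioriented.\<close>
  obtain s where s: "(e, s) \<in> dcycle_darts c" "bioriented \<O> e \<Longrightarrow> s = \<delta>"
  proof (cases "bioriented \<O> e")
    case True
    then show thesis using that signs(2) by blast
  next
    case False
    then show thesis using that e by (auto simp: is_min_edge_def dcycle_edges_def)
  qed
  have "{d \<in> dcycle_darts c. fst d \<noteq> e} \<subseteq> later G \<O> e"
    using c(2) e unfolding later_def is_min_edge_def dcycle_edges_def by blast
  then have "(dart_head G (e, s), dart_tail G (e, s)) \<in> (steps G (later G \<O> e))\<^sup>*"
    using steps_rtrancl_mono[OF dcycle_closing_steps[OF c(1) s(1)]] by simp
  then have "bad_cycle_at X \<delta> G \<O> e s"
    using s c(2) signs(1) by (auto simp: bad_cycle_at_def)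
  then show "\<exists>e s. bad_cycle_at X \<delta> G \<O> e s" by blast
next
  assume "\<exists>e s. bad_cycle_at X \<delta> G \<O> e s"
  then obtain e s where bad: "bad_cycle_at X \<delta> G \<O> e s" by blast
  then obtain c where c: "is_dcycle G c" "(e, s) \<in> dcycle_darts c"
    "dcycle_darts c \<subseteq> insert (e, s) (later G \<O> e)"
    using bad_cycle_at_simple[OF \<O>] by blast
  have "(e, s) \<in> \<O>" using bad by (simp add: bad_cycle_at_def)
  then have pot: "potential_cycle G \<O> c" and "e \<in> E G"
    using c \<O> by (auto simp: potential_cycle_def later_def fourientation_def)
  have "is_min_edge G (dcycle_edges c) e"
    unfolding is_min_edge_def
  proof (intro conjI ballI)
    show "e \<in> dcycle_edges c" using c(2) by (force simp: dcycle_edges_def)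
    show "(e, f) \<in> le G" if "f \<in> dcycle_edges c" for f
      using that c(3) oog_le_refl[OF G \<open>e \<in> E G\<close>] by (auto simp: dcycle_edges_def later_def)
  qed
  then have "bad_cycle X \<delta> G \<O> c"
    using bad c(2) min_edge_eq[OF G] by (auto simp: bad_cycle_def Let_def bad_cycle_at_def)
  with pot show "\<exists>c. potential_cycle G \<O> c \<and> bad_cycle X \<delta> G \<O> c" by blast
qed

section \<open>Bad cycles under isomorphism and in cycle minors\<close>

lemma bad_cycle_at_isomorphic:
  assumes G: "ordered_oriented_graph G" and \<O>: "fourientation G \<O>"
    and iso: "isomorphic G \<O> H \<Q>" and bad: "bad_cycle_at X \<delta> G \<O> e s"
  shows "\<exists>f. bad_cycle_at X \<delta> H \<Q> f s"
proof -
  obtain p q where "inj_on p (V G)" "V H = p ` V G" "E H = q ` E G"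
    and le: "\<And>e f. e \<in> E G \<Longrightarrow> f \<in> E G \<Longrightarrow> (q e, q f) \<in> le H \<longleftrightarrow> (e, f) \<in> le G"
    and or: "\<And>e s. e \<in> E G \<Longrightarrow> (q e, s) \<in> \<Q> \<longleftrightarrow> (e, s) \<in> \<O>"
    and ends: "\<And>e s. e \<in> E G \<Longrightarrow> dart_tail H (q e, s) = p (dart_tail G (e, s))"
      "\<And>e s. e \<in> E G \<Longrightarrow> dart_head H (q e, s) = p (dart_head G (e, s))"
    by (rule isomorphicE[OF iso]) (rule that)
  \<comment> \<open>Injectivity on edges follows from the order: edges with equal images are related
    both ways. It is used because \<open>later\<close> excludes the edge itself.\<close>
  have inj: "e = f" if "e \<in> E G" "f \<in> E G" "q e = q f" for e f
    using oog_le_antisym[OF G, of e f] oog_le_refl[OF G that(1)] le[OF that(1,1)] le[OF that(1,2)]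
      le[OF that(2,1)] that(3) by simp
  have eE: "e \<in> E G" using bad \<O> by (auto simp: bad_cycle_at_def fourientation_def)
  have "(p x, p y) \<in> (steps H (later H \<Q> (q e)))\<^sup>*" if "(x, y) \<in> (steps G (later G \<O> e))\<^sup>*" for x y
    using that
  proof (induct rule: rtrancl_induct)
    case (step y z)
    then obtain f t where f: "(f, t) \<in> later G \<O> e" "y = dart_tail G (f, t)" "z = dart_head G (f, t)"
      by (auto simp: steps_def)
    then have fE: "f \<in> E G" using \<O> by (auto simp: later_def fourientation_def)
    then have "(q f, t) \<in> later H \<Q> (q e)"
      using f(1) le[OF eE fE] or[OF fE] inj[OF fE eE] by (auto simp: later_def)
    then have "(p y, p z) \<in> steps H (later H \<Q> (q e))"
      unfolding steps_def f ends[OF fE, symmetric] by (rule imageI)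
    then show ?case using step(3) by simp
  qed simp
  moreover have "edge_signs \<Q> (q e) = edge_signs \<O> e" using or[OF eE] by (simp add: edge_signs_def)
  ultimately have "bad_cycle_at X \<delta> H \<Q> (q e) s"
    using bad or[OF eE] ends[OF eE]
    by (simp add: bad_cycle_at_def flip: edge_signs_UNIV_iff)
  then show ?thesis by blast
qed

lemma cycle_minor_simps [simp]:
  "arcs (gr (cycle_minor G c)) = E G \<inter> cycle_edges c"
  "verts (gr (cycle_minor G c)) =
    {v \<in> V G. \<exists>e \<in> E G \<inter> cycle_edges c. v = tail (gr G) e \<or> v = head (gr G) e}"
  "tail (gr (cycle_minor G c)) = tail (gr G)" "head (gr (cycle_minor G c)) = head (gr G)"
  "le (cycle_minor G c) = Restr (le G) (E G \<inter> cycle_edges c)"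
  by (auto simp: cycle_minor_def remove_isolated_def Diff_Diff_Int)

lemma dart_ends_cycle_minor [simp]:
  "dart_tail (cycle_minor G c) d = dart_tail G d" "dart_head (cycle_minor G c) d = dart_head G d"
  by (cases d; cases "snd d"; simp)+

lemma steps_cycle_minor [simp]: "steps (cycle_minor G c) D = steps G D"
  by (simp add: steps_def)

lemma oog_cycle_minor:
  assumes G: "ordered_oriented_graph G" and c: "is_cycle G c"
  shows "ordered_oriented_graph (cycle_minor G c)"
proof (rule oogI)
  note wf = wf_digraph.wellformed[OF oog_wf[OF G]]
  let ?M = "cycle_minor G c" and ?n = "length c"
  show "fin_digraph (gr ?M)"
    using fin_digraph.finite_verts[OF oog_fin[OF G]] fin_digraph.finite_arcs[OF oog_fin[OF G]] wf
    by unfold_locales auto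
  have edge: "snd (c ! i) \<in> E ?M" and ends: "{tail (gr G) (snd (c ! i)), head (gr G) (snd (c ! i))} =
      {fst (c ! i), fst (c ! (Suc i mod ?n))}" if "i < ?n" for i
    using c that by (auto simp: is_cycle_def cycle_edges_def)
  have "c \<noteq> []" using c by (simp add: is_cycle_def)
  then have "snd (c ! 0) \<in> E ?M" using edge by simp
  then have "tail (gr G) (snd (c ! 0)) \<in> V ?M" using wf by auto
  then show "V ?M \<noteq> {}" by blast
  show "cut_edges ?M U \<noteq> {}" if U: "is_cut ?M U" for U
  proof
    assume none: "cut_edges ?M U = {}"
    have "tail (gr G) e \<in> U \<longleftrightarrow> head (gr G) e \<in> U" if "e \<in> E ?M" for e
    proof -
      have "tail (gr G) e \<in> V ?M" "head (gr G) e \<in> V ?M" using that wf by auto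
      then show ?thesis using none that by (auto simp: cut_edges_def)
    qed
    \<comment> \<open>A set crossed by no edge of the minor contains either all or none of the
      vertices listed in the cycle, and without isolated vertices the minor has no others.\<close>
    then have adj: "fst (c ! i) \<in> U \<longleftrightarrow> fst (c ! (Suc i mod ?n)) \<in> U" if "i < ?n" for i
      using edge[OF that] ends[OF that] by (metis doubleton_eq_iff)
    have all: "fst (c ! i) \<in> U \<longleftrightarrow> fst (c ! 0) \<in> U" if "i < ?n" for i
      using that
    proof (induct i)
      case (Suc i)
      then show ?case using adj[of i] by simp
    qed simp
    have "v \<in> U \<longleftrightarrow> fst (c ! 0) \<in> U" if v: "v \<in> V ?M" for v
    proof -
      obtain a where "a \<in> set c" "v = tail (gr G) (snd a) \<or> v = head (gr G) (snd a)"
        using v unfolding cycle_minor_simps cycle_edges_def by blast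
      then obtain i where i: "i < ?n" "v = tail (gr G) (snd (c ! i)) \<or> v = head (gr G) (snd (c ! i))"
        by (metis in_set_conv_nth)
      then have "v \<in> {fst (c ! i), fst (c ! (Suc i mod ?n))}" using ends[OF i(1)] by auto
      then show ?thesis using all[OF i(1)] adj[OF i(1)] by auto
    qed
    then show False using U unfolding is_cut_def by blast
  qed
  show "linear_order_on (E ?M) (le ?M)"
    using G by (auto simp: ordered_oriented_graph_def intro: linear_order_on_Restr)
qed

lemma simple_cycle_of_dcycle:
  assumes "is_dcycle G c" "distinct (map fst c)"
  shows "simple_cycle G (map (map_prod id fst) c)"
proof -
  have "{tail (gr G) (fst d), head (gr G) (fst d)} = {dart_tail G d, dart_head G d}" for d
    by (cases d; cases "snd d") auto
  then show ?thesis
    using assms by (auto simp: simple_cycle_def is_cycle_def is_dcycle_def darts_def comp_def mem_Times_iff)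
qed

text \<open>The walk closing a bad minimum can be shortened to a simple cycle, which lies entirely
  in its own minor.\<close>

lemma bad_cycle_at_minor:
  assumes \<O>: "fourientation G \<O>" and bad: "bad_cycle_at X \<delta> G \<O> e s"
  shows "\<exists>c. simple_cycle G c \<and>
    bad_cycle_at X \<delta> (cycle_minor G c) (restrict_fourientation \<O> (cycle_edges c)) e s"
proof -
  obtain c where c: "is_dcycle G c" "distinct (map fst c)" "(e, s) \<in> dcycle_darts c"
    "dcycle_darts c \<subseteq> insert (e, s) (later G \<O> e)"
    using bad_cycle_at_simple[OF assms] by blast
  let ?c = "map (map_prod id fst) c"
  let ?R = "restrict_fourientation \<O> (cycle_edges ?c)"
  have edges: "cycle_edges ?c = fst ` dcycle_darts c"
    by (auto simp: cycle_edges_def dcycle_darts_def image_iff) force+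
  have eS: "e \<in> cycle_edges ?c" using c(3) unfolding edges by force
  have "dcycle_darts c \<subseteq> \<O>" using c(4) bad by (auto simp: later_def bad_cycle_at_def)
  then have "dcycle_darts c \<subseteq> ?R"
    unfolding restrict_fourientation_def edges by force
  moreover have "dcycle_darts c \<subseteq> darts G" using \<open>dcycle_darts c \<subseteq> \<O>\<close> \<O> by (auto simp: fourientation_def)
  ultimately have "{d \<in> dcycle_darts c. fst d \<noteq> e} \<subseteq> later (cycle_minor G ?c) ?R e"
  proof (intro subsetI)
    fix d assume d: "d \<in> {d \<in> dcycle_darts c. fst d \<noteq> e}"
    then have "d \<in> later G \<O> e" using c(4) by auto
    then have "(e, fst d) \<in> le G" by (simp add: later_def)
    moreover have "e \<in> E G" "fst d \<in> E G"
      using d c(3) \<open>dcycle_darts c \<subseteq> darts G\<close> by (auto simp: darts_def)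
    moreover have "fst d \<in> cycle_edges ?c" using d unfolding edges by blast
    ultimately show "d \<in> later (cycle_minor G ?c) ?R e"
      using d eS \<open>dcycle_darts c \<subseteq> ?R\<close> unfolding later_def cycle_minor_simps by blast
  qed
  then have "(dart_head G (e, s), dart_tail G (e, s)) \<in> (steps G (later (cycle_minor G ?c) ?R e))\<^sup>*"
    using steps_rtrancl_mono[OF dcycle_closing_steps[OF c(1,3)]] by simp
  moreover have "(e, s) \<in> ?R" using \<open>dcycle_darts c \<subseteq> ?R\<close> c(3) by blast
  ultimately have "bad_cycle_at X \<delta> (cycle_minor G ?c) ?R e s"
    using bad edge_signs_restrict[OF eS, of \<O>]
    by (simp add: bad_cycle_at_def flip: edge_signs_UNIV_iff)
  then show ?thesis using simple_cycle_of_dcycle[OF c(1,2)] by blast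
qed

text \<open>A minor only deletes edges, so its closing walk is also one in \<open>G\<close>.\<close>

lemma bad_cycle_at_of_minor:
  assumes bad: "bad_cycle_at X \<delta> (cycle_minor G c) (restrict_fourientation \<O> (cycle_edges c)) e s"
  shows "bad_cycle_at X \<delta> G \<O> e s"
proof -
  let ?R = "restrict_fourientation \<O> (cycle_edges c)"
  have "(e, s) \<in> ?R" using bad by (simp add: bad_cycle_at_def)
  then have e: "(e, s) \<in> \<O>" "e \<in> cycle_edges c" by (auto simp: restrict_fourientation_def)
  have "later (cycle_minor G c) ?R e \<subseteq> later G \<O> e"
    by (auto simp: later_def restrict_fourientation_def)
  moreover have "(dart_head G (e, s), dart_tail G (e, s)) \<in> (steps G (later (cycle_minor G c) ?R e))\<^sup>*"
    using bad by (simp add: bad_cycle_at_def)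
  ultimately have "(dart_head G (e, s), dart_tail G (e, s)) \<in> (steps G (later G \<O> e))\<^sup>*"
    by (rule steps_rtrancl_mono[rotated])
  then show ?thesis
    using bad e(1) edge_signs_restrict[OF e(2), of \<O>]
    by (simp add: bad_cycle_at_def flip: edge_signs_UNIV_iff)
qed

lemma cycle_property_if_bad_cycle_at:
  fixes P :: "('v, 'e) property"
  assumes P: "\<And>G \<O>. ordered_oriented_graph G \<Longrightarrow> fourientation G \<O> \<Longrightarrow>
    P G \<O> \<longleftrightarrow> \<not> (\<exists>e s. bad_cycle_at X \<delta> G \<O> e s)"
  shows "cycle_property P"
  unfolding cycle_property_def
proof (intro conjI allI impI)
  have transport: "P H \<Q>" if G: "ordered_oriented_graph G" "fourientation G \<O>"
    and H: "ordered_oriented_graph H" "fourientation H \<Q>"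
    and iso: "isomorphic G \<O> H \<Q>" and good: "P G \<O>" for G H :: "('v, 'e) ograph" and \<O> \<Q>
    unfolding P[OF H]
  proof (intro notI, elim exE)
    fix e s
    assume "bad_cycle_at X \<delta> H \<Q> e s"
    from bad_cycle_at_isomorphic[OF H isomorphic_sym[OF G(1) H(1) iso] this]
    show False using good unfolding P[OF G] by blast
  qed
  show "fourientation_property P"
    unfolding fourientation_property_def
  proof (intro allI impI, elim conjE)
    fix G H :: "('v, 'e) ograph" and \<O> \<Q>
    assume A: "ordered_oriented_graph G" "fourientation G \<O>" "ordered_oriented_graph H"
      "fourientation H \<Q>" and iso: "isomorphic G \<O> H \<Q>"
    show "P G \<O> \<longleftrightarrow> P H \<Q>"
      using transport[OF A iso] transport[OF A(3,4,1,2) isomorphic_sym[OF A(1,3) iso]] by (rule iffI)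
  qed
  fix G :: "('v, 'e) ograph" and \<O>
  assume "ordered_oriented_graph G \<and> fourientation G \<O>"
  then have G: "ordered_oriented_graph G" and \<O>: "fourientation G \<O>" by auto
  have minor: "P (cycle_minor G c) (restrict_fourientation \<O> (cycle_edges c)) \<longleftrightarrow>
      \<not> (\<exists>e s. bad_cycle_at X \<delta> (cycle_minor G c) (restrict_fourientation \<O> (cycle_edges c)) e s)"
    if "simple_cycle G c" for c
  proof (rule P)
    show "ordered_oriented_graph (cycle_minor G c)"
      using oog_cycle_minor[OF G] that by (simp add: simple_cycle_def)
    show "fourientation (cycle_minor G c) (restrict_fourientation \<O> (cycle_edges c))"
      using \<O> by (auto simp: fourientation_def restrict_fourientation_def darts_def)
  qed
  show "P G \<O> \<longleftrightarrow> (\<forall>c. simple_cycle G c \<longrightarrow>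
      P (cycle_minor G c) (restrict_fourientation \<O> (cycle_edges c)))"
    unfolding P[OF G \<O>]
  proof (intro iffI allI impI notI; (elim exE)?)
    fix c
    assume "\<not> (\<exists>e s. bad_cycle_at X \<delta> G \<O> e s)" "simple_cycle G c"
    then show "P (cycle_minor G c) (restrict_fourientation \<O> (cycle_edges c))"
      unfolding minor[OF \<open>simple_cycle G c\<close>] by (blast dest: bad_cycle_at_of_minor)
  next
    fix e s
    assume minors: "\<forall>c. simple_cycle G c \<longrightarrow>
        P (cycle_minor G c) (restrict_fourientation \<O> (cycle_edges c))"
      and bad: "bad_cycle_at X \<delta> G \<O> e s"
    obtain c where c: "simple_cycle G c"
      "bad_cycle_at X \<delta> (cycle_minor G c) (restrict_fourientation \<O> (cycle_edges c)) e s"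
      using bad_cycle_at_minor[OF \<O> bad] by blast
    show False using minors[rule_format, OF c(1)] c(2) unfolding minor[OF c(1)] by blast
  qed
qed

section \<open>Contracting the maximum edge, and exchanging closing walks\<close>

text \<open>\<open>D\<close> is a set of orientations of the maximum edge, which is larger than any other edge \<open>f\<close>:
  adding it to \<open>\<O>\<close> only adds \<open>D\<close> to the darts available for closing a cycle, and contracting
  the maximum edge amounts to adding both orientations.\<close>

definition closes_with ::
  "sign set set \<Rightarrow> sign \<Rightarrow> ('v, 'e) ograph \<Rightarrow> 'e dart set \<Rightarrow> 'e dart set \<Rightarrow> 'e \<Rightarrow> sign \<Rightarrow> bool" where
  "closes_with X \<delta> G \<O> D f t \<longleftrightarrow> (f, t) \<in> \<O> \<and> edge_signs \<O> f \<in> X \<and> (bioriented \<O> f \<longrightarrow> t = \<delta>) \<and>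
     (dart_head G (f, t), dart_tail G (f, t)) \<in> (steps G (later G \<O> f \<union> D))\<^sup>*"

lemma closes_with_mono:
  assumes "closes_with X \<delta> G \<O> D f t" "D \<subseteq> D'"
  shows "closes_with X \<delta> G \<O> D' f t"
proof -
  have "later G \<O> f \<union> D \<subseteq> later G \<O> f \<union> D'" using assms(2) by blast
  note mono = steps_rtrancl_mono[OF _ this]
  show ?thesis using assms(1) mono[of "dart_head G (f, t)" "dart_tail G (f, t)"]
    by (simp add: closes_with_def)
qed

lemma bad_cycle_at_add_max:
  assumes G: "ordered_oriented_graph G" and e: "is_max_edge G e" "\<not> is_loop G e"
    and \<O>: "fourientation (contract G {e}) \<O>" and D: "D \<subseteq> {e} \<times> UNIV"
  shows "bad_cycle_at X \<delta> G (\<O> \<union> D) f t \<longleftrightarrow> closes_with X \<delta> G \<O> D f t"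
proof -
  have eO: "fst d \<in> E G \<and> fst d \<noteq> e" if "d \<in> \<O>" for d
    using \<O> that by (auto simp: fourientation_def darts_def)
  show ?thesis
  proof (cases "f = e")
    case True
    \<comment> \<open>The maximum edge has no later darts, and as it is not a loop the empty walk
      does not close it. So it is never the minimum of a bad cycle.\<close>
    have "d \<notin> later G (\<O> \<union> D) e" for d
    proof
      assume d: "d \<in> later G (\<O> \<union> D) e"
      then have "d \<in> \<O>" using D by (auto simp: later_def)
      then have "(fst d, e) \<in> le G" using e(1) eO by (simp add: is_max_edge_def)
      then show False using d oog_le_antisym[OF G, of e "fst d"] by (simp add: later_def)
    qed
    then have "later G (\<O> \<union> D) e = {}" by blast
    moreover have "dart_head G (e, t) \<noteq> dart_tail G (e, t)"
      using e by (cases t) (auto simp: is_loop_def is_max_edge_def)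
    ultimately have "\<not> bad_cycle_at X \<delta> G (\<O> \<union> D) f t"
      by (auto simp: bad_cycle_at_def True steps_def)
    moreover have "\<not> closes_with X \<delta> G \<O> D f t" using eO True by (force simp: closes_with_def)
    ultimately show ?thesis by blast
  next
    case False
    have mem: "(f, t) \<in> \<O> \<union> D \<longleftrightarrow> (f, t) \<in> \<O>" using D False by auto
    have signs: "edge_signs (\<O> \<union> D) f = edge_signs \<O> f" using D False by (auto simp: edge_signs_def)
    have "later G (\<O> \<union> D) f = later G \<O> f \<union> D" if "(f, t) \<in> \<O>"
      using D False e(1) eO[OF that] by (auto simp: later_def is_max_edge_def)
    then show ?thesis
      unfolding bad_cycle_at_def closes_with_def mem edge_signs_UNIV_iff[symmetric] signs by auto
  qed
qed

lemma bad_cycle_at_contract_max: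
  assumes G: "ordered_oriented_graph G" and e: "is_max_edge G e"
    and \<O>: "fourientation (contract G {e}) \<O>"
  shows "bad_cycle_at X \<delta> (contract G {e}) \<O> f t \<longleftrightarrow> closes_with X \<delta> G \<O> ({e} \<times> UNIV) f t"
proof -
  note wf = oog_wf[OF G]
  have eO: "fst d \<in> E G \<and> fst d \<noteq> e" if "d \<in> \<O>" for d
    using \<O> that by (auto simp: fourientation_def darts_def)
  have "(dart_head (contract G {e}) (f, t), dart_tail (contract G {e}) (f, t)) \<in>
      (steps (contract G {e}) (later (contract G {e}) \<O> f))\<^sup>* \<longleftrightarrow>
    (dart_head G (f, t), dart_tail G (f, t)) \<in> (steps G (later G \<O> f \<union> {e} \<times> UNIV))\<^sup>*"
    if f: "(f, t) \<in> \<O>"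
  proof -
    have "later (contract G {e}) \<O> f = later G \<O> f"
      using eO[OF f] eO by (auto simp: later_def)
    moreover have "later G \<O> f \<subseteq> darts G"
      using eO by (auto simp: later_def darts_def mem_Times_iff)
    moreover have "dart_head G (f, t) \<in> V G" "dart_tail G (f, t) \<in> V G"
      using dart_in_verts[OF wf, of "(f, t)"] eO[OF f] by auto
    ultimately show ?thesis
      using steps_contract_iff[OF wf, of "{e}"] e by (simp add: is_max_edge_def)
  qed
  then show ?thesis by (auto simp: bad_cycle_at_def closes_with_def)
qed

text \<open>A walk that traverses an edge in both directions revisits a vertex and can be shortened,
  so one direction suffices.\<close>

lemma rtrancl_insert_converse_pair:
  assumes "(a, b) \<in> (insert (x, y) (insert (y, x) R))\<^sup>*"
  shows "(a, b) \<in> (insert (x, y) R)\<^sup>* \<or> (a, b) \<in> (insert (y, x) R)\<^sup>*"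
  using assms unfolding rtrancl_insert
  by (auto dest: rtrancl_trans[of a y R b] rtrancl_trans[of a x R b])

text \<open>With \<open>f\<close> at most \<open>g\<close>, every dart later than \<open>g\<close>
  is also later than \<open>f\<close>, so the walk closing \<open>g\<close> may be used when closing
  \<open>f\<close>.\<close>

lemma closes_with_swap:
  assumes G: "ordered_oriented_graph G" and \<O>: "fourientation G \<O>"
    and f: "closes_with X \<delta> G \<O> {(e, u)} f t" and g: "closes_with X \<delta> G \<O> {(e, opp u)} g t'"
    and le: "(f, g) \<in> le G"
  shows "\<exists>h r. closes_with X \<delta> G \<O> {} h r"
proof (rule ccontr)
  assume none: "\<not> ?thesis"
  let ?S = "\<lambda>h. steps G (later G \<O> h)"
  let ?x = "dart_tail G (e, u)" and ?y = "dart_head G (e, u)"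
  have "steps G (later G \<O> h \<union> {(e, r)}) = insert (dart_tail G (e, r), dart_head G (e, r)) (?S h)" for h r
    by (auto simp: steps_def)
  then have "(dart_head G (f, t), dart_tail G (f, t)) \<in> (insert (?x, ?y) (?S f))\<^sup>*"
    "(dart_head G (g, t'), dart_tail G (g, t')) \<in> (insert (?y, ?x) (?S g))\<^sup>*"
    using f g by (auto simp: closes_with_def)
  moreover have "(dart_head G (f, t), dart_tail G (f, t)) \<notin> (?S f)\<^sup>*"
    "(dart_head G (g, t'), dart_tail G (g, t')) \<notin> (?S g)\<^sup>*"
    using none f g by (auto simp: closes_with_def)
  \<comment> \<open>Neither walk closes without \<open>e\<close>, so each splits at its traversal of
    \<open>e\<close>, the two in opposite directions.\<close>
  ultimately have fx: "(dart_head G (f, t), ?x) \<in> (?S f)\<^sup>*" and yf: "(?y, dart_tail G (f, t)) \<in> (?S f)\<^sup>*"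
    and gy: "(dart_head G (g, t'), ?y) \<in> (?S g)\<^sup>*" and xg: "(?x, dart_tail G (g, t')) \<in> (?S g)\<^sup>*"
    and notf: "(dart_head G (f, t), dart_tail G (f, t)) \<notin> (?S f)\<^sup>*"
    by (auto simp: rtrancl_insert)
  have fO: "(f, t) \<in> \<O>" and gO: "(g, t') \<in> \<O>" using f g by (auto simp: closes_with_def)
  show False
  proof (cases "f = g")
    case True
    \<comment> \<open>Opposite signs would make \<open>f\<close> bioriented, and then both signs
      equal \<delta>. With equal signs, the first part of one walk and the last part of the other
      meet in \<open>?x\<close> and close \<open>f\<close> without \<open>e\<close>.\<close>
    have "t = t'"
    proof (rule ccontr)
      assume "t \<noteq> t'"
      then have "bioriented \<O> f"
        using fO gO True by (cases t; cases t') (auto simp: bioriented_def)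
      then show False using f g True \<open>t \<noteq> t'\<close> by (auto simp: closes_with_def)
    qed
    then show False using fx xg notf True rtrancl_trans by fastforce
  next
    case False
    have "(g, t') \<in> later G \<O> f" using le gO False by (auto simp: later_def)
    then have "(dart_tail G (g, t'), dart_head G (g, t')) \<in> ?S f" unfolding steps_def by blast
    moreover have "later G \<O> g \<subseteq> later G \<O> f"
      using oog_le_trans[OF G le] oog_le_antisym[OF G le] by (auto simp: later_def)
    then have sub: "(?S g)\<^sup>* \<subseteq> (?S f)\<^sup>*" by (intro rtrancl_mono steps_mono)
    \<comment> \<open>The detour around \<open>e\<close>: from \<open>?x\<close> to the tail of
      \<open>(g, t')\<close>, across it, and on to \<open>?y\<close>.\<close>
    ultimately have "(?x, ?y) \<in> (?S f)\<^sup>*"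
      using subsetD[OF sub xg] subsetD[OF sub gy] by (meson rtrancl.rtrancl_into_rtrancl rtrancl_trans)
    then show False using fx yf notf by (meson rtrancl_trans)
  qed
qed

lemma closes_with_split:
  assumes "closes_with X \<delta> G \<O> {(e, Plus), (e, Minus)} f t"
  shows "closes_with X \<delta> G \<O> {(e, Plus)} f t \<or> closes_with X \<delta> G \<O> {(e, Minus)} f t"
proof -
  have *: "steps G (later G \<O> f \<union> {(e, Plus), (e, Minus)}) =
      insert (tail (gr G) e, head (gr G) e) (insert (head (gr G) e, tail (gr G) e) (steps G (later G \<O> f)))"
    "steps G (later G \<O> f \<union> {(e, Plus)}) = insert (tail (gr G) e, head (gr G) e) (steps G (later G \<O> f))"
    "steps G (later G \<O> f \<union> {(e, Minus)}) = insert (head (gr G) e, tail (gr G) e) (steps G (later G \<O> f))"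
    by (auto simp: steps_def)
  show ?thesis
    using assms rtrancl_insert_converse_pair[of "dart_head G (f, t)" "dart_tail G (f, t)"
        "tail (gr G) e" "head (gr G) e" "steps G (later G \<O> f)"]
    unfolding closes_with_def * by blast
qed

lemma tutte_cycle_property_if_min_edge_cycle_property:
  fixes P :: "('v, 'e) property"
  assumes "min_edge_cycle_property P"
  shows "tutte_cycle_property P"
proof -
  obtain X \<delta> where all_good: "\<forall>G \<O>. ordered_oriented_graph G \<and> fourientation G \<O> \<longrightarrow>
      (P G \<O> \<longleftrightarrow> (\<forall>c. potential_cycle G \<O> c \<longrightarrow> \<not> bad_cycle X \<delta> G \<O> c))"
    using assms unfolding min_edge_cycle_property_def by (elim exE conjE)
  note good = all_good[rule_format, OF conjI]
  have P: "P G \<O> \<longleftrightarrow> \<not> (\<exists>e s. bad_cycle_at X \<delta> G \<O> e s)"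
    if "ordered_oriented_graph G" "fourientation G \<O>" for G \<O>
    using good[OF that] ex_bad_cycle_iff[OF that] by blast
  have T2: "(P (contract G {e}) \<O> \<longrightarrow> P G (\<O> \<union> {(e, Plus)}) \<and> P G (\<O> \<union> {(e, Minus)})) \<and>
    (\<not> P (contract G {e}) \<O> \<and> P G \<O> \<longrightarrow>
      (P G (\<O> \<union> {(e, Plus)}) \<longleftrightarrow> \<not> P G (\<O> \<union> {(e, Minus)}))) \<and>
    (P (contract G {e}) \<O> \<longleftrightarrow> P G (\<O> \<union> {(e, Plus), (e, Minus)}))"
    if G: "ordered_oriented_graph G" and e: "is_max_edge G e" "\<not> is_loop G e"
      and \<O>: "fourientation (contract G {e}) \<O>" for G :: "('v, 'e) ograph" and e \<O>
  proof -
    have eE: "{e} \<subseteq> E G" using e(1) by (simp add: is_max_edge_def)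
    note H = oog_contract[OF G eE]
    have \<O>G: "fourientation G \<O>" using \<O> by (auto simp: fourientation_def darts_def)
    let ?closes = "closes_with X \<delta> G \<O>"
    have UN: "{e} \<times> UNIV = {(e, Plus), (e, Minus)}" by (auto intro: sign.exhaust)
    \<comment> \<open>The contraction behaves like \<open>G\<close> with \<open>e\<close>
      bioriented, so here too all cases are instances of \<open>closes_with\<close> with different
      \<open>D\<close>.\<close>
    have PH: "P (contract G {e}) \<O> \<longleftrightarrow> \<not> (\<exists>f t. ?closes {(e, Plus), (e, Minus)} f t)"
      unfolding P[OF H \<O>] bad_cycle_at_contract_max[OF G e(1) \<O>] UN by (rule refl)
    have PG: "P G (\<O> \<union> D) \<longleftrightarrow> \<not> (\<exists>f t. ?closes D f t)" if D: "D \<subseteq> {e} \<times> UNIV" for D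
    proof -
      have "fourientation G (\<O> \<union> D)"
        using \<O>G D eE by (auto simp: fourientation_def darts_def)
      show ?thesis
        unfolding P[OF G \<open>fourientation G (\<O> \<union> D)\<close>] bad_cycle_at_add_max[OF G e \<O> D] by (rule refl)
    qed
    note one_bad = closes_with_split[of X \<delta> G \<O> e]
    have both_bad: "\<exists>f t. ?closes {} f t" if "?closes {(e, Plus)} f t" "?closes {(e, Minus)} g t'" for f t g t'
    proof -
      have "f \<in> E G" "g \<in> E G" using that \<O>G by (auto simp: closes_with_def fourientation_def)
      then have "(f, g) \<in> le G \<or> (g, f) \<in> le G" using oog_le_total[OF G] by blast
      then show ?thesis
        using closes_with_swap[OF G \<O>G that(1), of g t'] closes_with_swap[OF G \<O>G that(2), of f t] that
        unfolding opp.simps by blast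
    qed
    have "P (contract G {e}) \<O> \<longleftrightarrow> P G (\<O> \<union> {(e, Plus), (e, Minus)})"
      unfolding PG[of "{(e, Plus), (e, Minus)}", unfolded UN, OF subset_refl] PH by (rule refl)
    moreover have "P G (\<O> \<union> {(e, s)})" if "P (contract G {e}) \<O>" for s
    proof -
      have "{(e, s)} \<subseteq> {(e, Plus), (e, Minus)}" by (cases s) auto
      note mono = closes_with_mono[of X \<delta> G \<O>, OF _ this]
      have "{(e, s)} \<subseteq> {e} \<times> UNIV" by blast
      note PG_s = PG[OF this]
      show ?thesis unfolding PG_s using that mono unfolding PH by blast
    qed
    moreover have "P G (\<O> \<union> {(e, Plus)}) \<longleftrightarrow> \<not> P G (\<O> \<union> {(e, Minus)})"
      if bad: "\<not> P (contract G {e}) \<O>" and good: "P G \<O>"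
    proof -
      have "{(e, Plus)} \<subseteq> {e} \<times> UNIV" "{(e, Minus)} \<subseteq> {e} \<times> UNIV" by auto
      note signs = this[THEN PG]
      obtain f t where "?closes {(e, Plus), (e, Minus)} f t" using bad unfolding PH by blast
      \<comment> \<open>A walk closing with both orientations closes with one of them, so the two
        extensions are not both good; \<open>both_bad\<close> shows that they are not both
        bad.\<close>
      note one = one_bad[OF this]
      have "\<not> (\<exists>f t. ?closes {} f t)" using good PG[of "{}"] by simp
      then show ?thesis using one both_bad unfolding signs by blast
    qed
    ultimately show ?thesis by blast
  qed
  have T1: "\<exists>c. potential_cycle G \<O> c" if "ordered_oriented_graph G" "fourientation G \<O>" "\<not> P G \<O>" for G \<O>
    using good[OF that(1,2)] that(3) by blast
  show ?thesis
    unfolding tutte_cycle_property_def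
    using cycle_property_if_bad_cycle_at[OF P] T1 T2 by simp
qed

theorem theorem2p16:
  shows "(\<forall>P :: ('v, 'e) property. min_edge_cut_property P \<longrightarrow> tutte_cut_property P) \<and>
         (\<forall>P :: ('v, 'e) property. min_edge_cycle_property P \<longrightarrow> tutte_cycle_property P)"
  using tutte_cut_property_if_min_edge_cut_property tutte_cycle_property_if_min_edge_cycle_property
  by (intro conjI allI impI)

end
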